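(* Let $m\ge 1$, let $\Omega\subset\mathbb{R}^{m+1}$ be a domain, and let $Q$ be the quasilinear operator $$Q\phi=a^{ij}(x,D\phi)D_{ij}\phi+b(x,\phi,D\phi)$$ (summation over repeated indices), where $a^{ij}=a^{ij}(x,p)$ is $C^\infty$ on $\Omega\times\mathbb{R}^{m+1}$ and $b=b(x,z,p)$ is $C^\infty$ on $\Omega\times\mathbb{R}\times\mathbb{R}^{m+1}$. Let $\phi,\psi\in C^\infty(\Omega)$ satisfy $Q\phi\ge Q\psi$ in $\Omega$. Assume: (1) the matrix $(a^{ij})$ is nonnegative and $a^{ij}=a^{ji}$; (2) $\frac{\partial b}{\partial z}\le 0$; (3) there exist $C^\infty$ vector fields $X_1,\dots,X_r$ and $Y$ on $\Omega$ (depending on $D\phi(x)$) such that, as differential operators, $$a^{ij}(x,D\phi(x))D_{ij}=\sum_{k=1}^r X_k^2+Y.$$ Let $\Gamma$ be an integral curve of a vector field $Z\in\mathcal{L}(X_1,\dots,X_r)$. Suppose $\phi-\psi$ achieves a nonnegative maximum in $\Omega$ at a point of $\Gamma$. Then the maximum is attained at all points of $\Gamma$.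
   Context: $D\phi$ is the gradient and $D_{ij}\phi$ the second partial derivatives of $\phi$. For $C^\infty$ vector fields $X_1,\dots,X_r$ on $\Omega$, $\mathcal{L}(X_1,\dots,X_r)$ denotes the smallest $C^\infty(\Omega)$-module of vector fields which contains $X_1,\dots,X_r$ and is closed under the Lie bracket; its elements are finite sums of terms $\lambda[X_{i_1},[X_{i_2},\dots,[X_{i_{l-1}},X_{i_l}]]]$ with $\lambda\in C^\infty(\Omega)$ and $i_k\in\{1,\dots,r\}$ (including $l=1$, i.e. $\lambda X_{i_1}$). *)

theory Defs
  imports "HOL-Analysis.Analysis"
begin

text \<open>All notions below are meant for an open set \<open>S\<close> (or \<open>\<Omega>\<close>); the values of functions and
  vector fields outside of it are irrelevant.\<close>

primrec Ck_on :: "nat \<Rightarrow> 'a::real_normed_vector set \<Rightarrow> ('a \<Rightarrow> 'b::real_normed_vector) \<Rightarrow> bool" where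
  "Ck_on 0 S f \<longleftrightarrow> continuous_on S f"
| "Ck_on (Suc k) S f \<longleftrightarrow>
     (\<forall>x\<in>S. f differentiable (at x)) \<and>
     (\<forall>v. Ck_on k S (\<lambda>x. frechet_derivative f (at x) v))"

definition smooth_on :: "'a::real_normed_vector set \<Rightarrow> ('a \<Rightarrow> 'b::real_normed_vector) \<Rightarrow> bool" where
  "smooth_on S f \<longleftrightarrow> (\<forall>k. Ck_on k S f)"

definition pderiv_at :: "'n \<Rightarrow> (real^'n \<Rightarrow> real) \<Rightarrow> real^'n \<Rightarrow> real" where
  "pderiv_at i f x = frechet_derivative f (at x) (axis i 1)"

definition grad :: "(real^'n \<Rightarrow> real) \<Rightarrow> real^'n \<Rightarrow> real^'n" where
  "grad f x = (\<chi> i. pderiv_at i f x)"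

definition second_order_op :: "(real^'n \<Rightarrow> real^'n^'n) \<Rightarrow> (real^'n \<Rightarrow> real) \<Rightarrow> real^'n \<Rightarrow> real" where
  "second_order_op A f x = (\<Sum>i\<in>UNIV. \<Sum>j\<in>UNIV. A x $ i $ j * pderiv_at i (pderiv_at j f) x)"

definition quasilinear_op ::
  "(real^'n \<Rightarrow> real^'n \<Rightarrow> real^'n^'n) \<Rightarrow> (real^'n \<Rightarrow> real \<Rightarrow> real^'n \<Rightarrow> real) \<Rightarrow>
   (real^'n \<Rightarrow> real) \<Rightarrow> real^'n \<Rightarrow> real" where
  "quasilinear_op a b u x =
     second_order_op (\<lambda>y. a y (grad u y)) u x + b x (u x) (grad u x)"

text \<open>A vector field acting on a function as a first-order differential operator.\<close>

definition vf_apply :: "(real^'n \<Rightarrow> real^'n) \<Rightarrow> (real^'n \<Rightarrow> real) \<Rightarrow> real^'n \<Rightarrow> real" where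
  "vf_apply X f x = frechet_derivative f (at x) (X x)"

text \<open>In coordinates, the commutator \<open>X (Y f) - Y (X f)\<close> is the action on \<open>f\<close> of the field
  \<open>DY(X) - DX(Y)\<close>.\<close>

definition lie_bracket :: "(real^'n \<Rightarrow> real^'n) \<Rightarrow> (real^'n \<Rightarrow> real^'n) \<Rightarrow> real^'n \<Rightarrow> real^'n" where
  "lie_bracket X Y x =
     frechet_derivative Y (at x) (X x) - frechet_derivative X (at x) (Y x)"

text \<open>The smallest module of vector fields over the smooth functions on \<open>\<Omega>\<close> that contains \<open>F\<close> and
  is closed under the Lie bracket. The rule \<open>cong\<close> identifies fields that agree on \<open>\<Omega>\<close>.\<close>

inductive_set lie_module :: "(real^'n) set \<Rightarrow> (real^'n \<Rightarrow> real^'n) set \<Rightarrow> (real^'n \<Rightarrow> real^'n) set"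
  for \<Omega> :: "(real^'n) set" and F :: "(real^'n \<Rightarrow> real^'n) set" where
  base: "X \<in> F \<Longrightarrow> X \<in> lie_module \<Omega> F"
| zero: "(\<lambda>x. 0) \<in> lie_module \<Omega> F"
| add: "\<lbrakk>V \<in> lie_module \<Omega> F; W \<in> lie_module \<Omega> F\<rbrakk> \<Longrightarrow> (\<lambda>x. V x + W x) \<in> lie_module \<Omega> F"
| scale: "\<lbrakk>smooth_on \<Omega> c; V \<in> lie_module \<Omega> F\<rbrakk> \<Longrightarrow> (\<lambda>x. c x *\<^sub>R V x) \<in> lie_module \<Omega> F"
| bracket: "\<lbrakk>V \<in> lie_module \<Omega> F; W \<in> lie_module \<Omega> F\<rbrakk> \<Longrightarrow> lie_bracket V W \<in> lie_module \<Omega> F"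
| cong: "\<lbrakk>V \<in> lie_module \<Omega> F; \<And>x. x \<in> \<Omega> \<Longrightarrow> W x = V x\<rbrakk> \<Longrightarrow> W \<in> lie_module \<Omega> F"

text \<open>The trace of an integral curve. The parameter interval may be open, closed or half-open,
  bounded or not, and the curve need not be maximal.\<close>

definition integral_curve :: "(real^'n) set \<Rightarrow> (real^'n \<Rightarrow> real^'n) \<Rightarrow> (real^'n) set \<Rightarrow> bool" where
  "integral_curve \<Omega> Z \<Gamma> \<longleftrightarrow>
     (\<exists>I \<gamma>. is_interval I \<and> \<gamma> ` I \<subseteq> \<Omega> \<and> \<Gamma> = \<gamma> ` I \<and>
        (\<forall>t\<in>I. (\<gamma> has_vector_derivative Z (\<gamma> t)) (at t within I)))"

end

theory Submission
  imports Defs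
begin

text \<open>
  Let \<open>u = \<phi> - \<psi>\<close>, let \<open>M \<ge> 0\<close> be its maximum and \<open>F = {u = M}\<close>. Since \<open>\<phi>\<close> and \<open>\<psi>\<close> have the same
  gradient on \<open>F\<close>, local Lipschitz bounds for \<open>a\<close> and \<open>b\<close> turn \<open>Q\<phi> \<ge> Q\<psi>\<close> into
  \<open>\<Sum> X\<^sub>k\<^sup>2 u \<ge> - K (|Du| + (M - u))\<close> near each point of \<open>F\<close>; the sign of the \<open>z\<close>-derivative of \<open>b\<close>
  is needed only when \<open>M > 0\<close>. Hopf's barrier argument then shows that every \<open>X\<^sub>k\<close> is orthogonal to
  all proximal normals of \<open>F\<close>.

  Fields with this tangency property form a module, and a Gronwall argument for the distance to \<open>F\<close>
  shows that curves which are integral curves of such a field up to an error \<open>e\<close> leave \<open>F\<close> by at most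
  \<open>2 e t\<close>. No flows are needed: following second order Taylor polynomials along
  \<open>X, Y, -X, -Y\<close> and returning to \<open>F\<close> after each leg produces points \<open>x + s\<^sup>2 [X, Y] + o(s\<^sup>2)\<close>
  of \<open>F\<close>, so the bracket is tangent as well. With \<open>e = 0\<close> the same estimate keeps the integral
  curves of \<open>Z\<close> in \<open>F\<close>.
\<close>

section \<open>Calculus of \<open>C\<^sup>k\<close> functions\<close>

lemma Ck_on_SucD: "Ck_on (Suc k) S f \<Longrightarrow> Ck_on k S f"
proof (induction k arbitrary: f)
  case 0
  then show ?case
    by (simp add: continuous_at_imp_continuous_on differentiable_imp_continuous_within)
next
  case (Suc k)
  from Suc.prems have "\<forall>x\<in>S. f differentiable at x"
    and "\<And>v. Ck_on (Suc k) S (\<lambda>x. frechet_derivative f (at x) v)"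
    by simp_all
  with Suc.IH show ?case by simp
qed

lemma Ck_on_continuous: "Ck_on k S f \<Longrightarrow> continuous_on S f"
  by (induction k) (use Ck_on_SucD in \<open>auto simp del: Ck_on.simps(2)\<close>)

lemma Ck_on_cong:
  assumes "open S" "\<And>x. x \<in> S \<Longrightarrow> f x = g x" "Ck_on k S f"
  shows "Ck_on k S g"
  using assms(2,3)
proof (induction k arbitrary: f g)
  case 0
  then show ?case using continuous_on_eq by auto
next
  case (Suc k)
  have g: "(g has_derivative frechet_derivative f (at x)) (at x)" if "x \<in> S" for x
    using Suc.prems that assms(1)
    by (auto intro: has_derivative_transform_within_open simp: frechet_derivative_works)
  then have "frechet_derivative f (at x) v = frechet_derivative g (at x) v" if "x \<in> S" for x v
    using frechet_derivative_at[OF g[OF that]] by simp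
  moreover have "Ck_on k S (\<lambda>x. frechet_derivative f (at x) v)" for v
    using Suc.prems by simp
  ultimately have "Ck_on k S (\<lambda>x. frechet_derivative g (at x) v)" for v
    by (rule Suc.IH)
  then show ?case using g by (auto simp: differentiable_def)
qed

text \<open>Lets an explicit derivative stand in for \<open>frechet_derivative\<close>: the two
  agree on \<open>S\<close> by uniqueness of derivatives, and \<open>Ck_on\<close> respects equality
  on an open set.\<close>

lemma Ck_on_SucI:
  assumes "open S" "\<And>x. x \<in> S \<Longrightarrow> (f has_derivative f' x) (at x)"
    and "\<And>v. Ck_on k S (\<lambda>x. f' x v)"
  shows "Ck_on (Suc k) S f"
proof -
  have "Ck_on k S (\<lambda>x. frechet_derivative f (at x) v)" for v
    by (rule Ck_on_cong[OF assms(1) _ assms(3)[of v]]) (simp add: frechet_derivative_at[OF assms(2)])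
  then show ?thesis using assms(2) by (auto simp: differentiable_def)
qed

lemma Ck_on_has_derivative:
  "Ck_on (Suc k) S f \<Longrightarrow> x \<in> S \<Longrightarrow> (f has_derivative frechet_derivative f (at x)) (at x)"
  by (simp add: frechet_derivative_works)

lemma Ck_on_frechet: "Ck_on (Suc k) S f \<Longrightarrow> Ck_on k S (\<lambda>x. frechet_derivative f (at x) v)"
  by simp

lemma Ck_on_const: "open S \<Longrightarrow> Ck_on k S (\<lambda>x. c)"
proof (induction k arbitrary: c)
  case (Suc k)
  then show ?case by (intro Ck_on_SucI[where f'="\<lambda>x h. 0"]) auto
qed simp

lemma Ck_on_bounded_linear:
  assumes "open S" "bounded_linear h" "Ck_on k S f"
  shows "Ck_on k S (\<lambda>x. h (f x))"
  using assms(3)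
proof (induction k arbitrary: f)
  case 0
  then show ?case using assms(2) by (simp add: bounded_linear.continuous_on)
next
  case (Suc k)
  show ?case
    by (rule Ck_on_SucI[where f'="\<lambda>x v. h (frechet_derivative f (at x) v)"])
      (use assms Suc in \<open>auto intro: bounded_linear.has_derivative[OF assms(2) Ck_on_has_derivative]\<close>)
qed

lemma Ck_on_add:
  assumes "open S" "Ck_on k S f" "Ck_on k S g"
  shows "Ck_on k S (\<lambda>x. f x + g x)"
  using assms(2,3)
proof (induction k arbitrary: f g)
  case 0
  then show ?case by (simp add: continuous_on_add)
next
  case (Suc k)
  show ?case
    by (rule Ck_on_SucI[where f'="\<lambda>x v. frechet_derivative f (at x) v + frechet_derivative g (at x) v"])
      (use assms Suc in \<open>auto intro!: has_derivative_add Ck_on_has_derivative\<close>)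
qed

lemma Ck_on_minus: "open S \<Longrightarrow> Ck_on k S f \<Longrightarrow> Ck_on k S (\<lambda>x. - f x)"
  by (rule Ck_on_bounded_linear[OF _ bounded_linear_minus[OF bounded_linear_ident]])

lemma Ck_on_diff:
  "open S \<Longrightarrow> Ck_on k S f \<Longrightarrow> Ck_on k S g \<Longrightarrow> Ck_on k S (\<lambda>x. f x - g x)"
  using Ck_on_add[of S k f "\<lambda>x. - g x"] Ck_on_minus[of S k g] by simp

lemma Ck_on_scaleR:
  assumes "open S" "Ck_on k S c" "Ck_on k S f"
  shows "Ck_on k S (\<lambda>x. c x *\<^sub>R f x)"
  using assms(2,3)
proof (induction k arbitrary: c f)
  case 0
  then show ?case by (simp add: continuous_on_scaleR)
next
  case (Suc k)
  show ?case
  proof (rule Ck_on_SucI[OF assms(1)])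
    show "((\<lambda>x. c x *\<^sub>R f x) has_derivative
        (\<lambda>v. c x *\<^sub>R frechet_derivative f (at x) v + frechet_derivative c (at x) v *\<^sub>R f x)) (at x)"
      if "x \<in> S" for x
      using Suc.prems that by (auto intro!: has_derivative_scaleR Ck_on_has_derivative)
    show "Ck_on k S (\<lambda>x. c x *\<^sub>R frechet_derivative f (at x) v + frechet_derivative c (at x) v *\<^sub>R f x)" for v
      by (intro Ck_on_add assms(1) Suc.IH Ck_on_frechet) (use Suc.prems Ck_on_SucD in blast)+
  qed
qed

lemma Ck_on_sum:
  assumes "open S" "finite I" "\<And>i. i \<in> I \<Longrightarrow> Ck_on k S (f i)"
  shows "Ck_on k S (\<lambda>x. \<Sum>i\<in>I. f i x)"
  using assms(2,3)
  by (induction I rule: finite_induct) (auto simp: Ck_on_const Ck_on_add assms(1))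

lemma frechet_derivative_eq_sum_Basis:
  fixes f :: "'a::euclidean_space \<Rightarrow> 'b::real_normed_vector"
  assumes "f differentiable at x"
  shows "frechet_derivative f (at x) v = (\<Sum>b\<in>Basis. (v \<bullet> b) *\<^sub>R frechet_derivative f (at x) b)"
proof -
  have lin: "linear (frechet_derivative f (at x))"
    using assms by (rule linear_frechet_derivative)
  have "frechet_derivative f (at x) v = frechet_derivative f (at x) (\<Sum>b\<in>Basis. (v \<bullet> b) *\<^sub>R b)"
    by (simp add: euclidean_representation)
  then show ?thesis
    by (simp add: linear_sum[OF lin] linear_scale[OF lin])
qed

text \<open>\<open>Ck_on\<close> speaks about derivatives in constant directions only. Expanding
  \<open>X x\<close> in the standard basis turns the derivative along a variable field into a finite
  sum of products of \<open>Ck_on k\<close> functions.\<close>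

lemma Ck_on_directional_derivative:
  fixes f :: "'a::euclidean_space \<Rightarrow> 'b::real_normed_vector"
  assumes "open S" "Ck_on (Suc k) S f" "Ck_on k S X"
  shows "Ck_on k S (\<lambda>x. frechet_derivative f (at x) (X x))"
proof (rule Ck_on_cong[OF assms(1)])
  show "Ck_on k S (\<lambda>x. \<Sum>b\<in>Basis. (X x \<bullet> b) *\<^sub>R frechet_derivative f (at x) b)"
    using assms by (intro Ck_on_sum Ck_on_scaleR Ck_on_frechet
        Ck_on_bounded_linear[OF _ bounded_linear_inner_left]) auto
  show "(\<Sum>b\<in>Basis. (X x \<bullet> b) *\<^sub>R frechet_derivative f (at x) b) = frechet_derivative f (at x) (X x)"
    if "x \<in> S" for x
    using assms(2) that by (simp add: frechet_derivative_eq_sum_Basis[symmetric])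
qed

lemma Ck_on_exp:
  fixes g :: "'a::real_normed_vector \<Rightarrow> real"
  assumes "open S" "Ck_on k S g"
  shows "Ck_on k S (\<lambda>x. exp (g x))"
  using assms(2)
proof (induction k)
  case 0
  then show ?case by (simp add: continuous_on_exp)
next
  case (Suc k)
  show ?case
  proof (rule Ck_on_SucI[OF assms(1)])
    show "((\<lambda>x. exp (g x)) has_derivative (\<lambda>v. exp (g x) *\<^sub>R frechet_derivative g (at x) v)) (at x)"
      if "x \<in> S" for x
      using has_derivative_exp[OF Ck_on_has_derivative[OF Suc.prems that]] by (simp add: mult.commute)
    show "Ck_on k S (\<lambda>x. exp (g x) *\<^sub>R frechet_derivative g (at x) v)" for v
      using Suc assms(1) by (intro Ck_on_scaleR Suc.IH Ck_on_frechet; blast intro: Ck_on_SucD)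
  qed
qed

text \<open>Continuity of the partial derivatives makes the derivative of \<open>f\<close> minus its
  linearization at \<open>x0\<close> have operator norm at most \<open>e\<close> near
  \<open>x0\<close>, and the mean value inequality on a ball does the rest. Both points may vary,
  which plain differentiability at \<open>x0\<close> would not allow.\<close>

lemma strict_derivative:
  fixes f :: "'a::euclidean_space \<Rightarrow> 'b::real_normed_vector"
  assumes S: "open S" "x0 \<in> S" and f: "Ck_on 1 S f" and "e > 0"
  obtains d where "d > 0" "ball x0 d \<subseteq> S"
    "\<And>p q. p \<in> ball x0 d \<Longrightarrow> q \<in> ball x0 d \<Longrightarrow>
      norm (f p - f q - frechet_derivative f (at x0) (p - q)) \<le> e * norm (p - q)"
proof -
  let ?D = "\<lambda>x. frechet_derivative f (at x)"
  have diff: "f differentiable at x" if "x \<in> S" for x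
    using f that by simp
  \<comment> \<open>Each of the \<open>DIM('a)\<close> coordinate directions may contribute an equal
    share of \<open>e\<close>.\<close>
  define e' where "e' = e / DIM('a)"
  have "e' > 0" using \<open>e > 0\<close> by (simp add: e'_def)
  have "\<forall>\<^sub>F x in at x0. \<forall>b\<in>Basis. dist (?D x b) (?D x0 b) < e'"
  proof (rule eventually_ball_finite[OF finite_Basis], rule ballI)
    fix b :: 'a
    have "continuous_on S (\<lambda>x. ?D x b)" using f by simp
    then have "isCont (\<lambda>x. ?D x b) x0"
      using S by (simp add: continuous_on_eq_continuous_at)
    then show "\<forall>\<^sub>F x in at x0. dist (?D x b) (?D x0 b) < e'"
      using \<open>e' > 0\<close> by (simp add: isCont_def tendsto_iff)
  qed
  then obtain d1 where d1: "d1 > 0"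
    "\<And>x b. x \<noteq> x0 \<Longrightarrow> dist x x0 < d1 \<Longrightarrow> b \<in> Basis \<Longrightarrow> dist (?D x b) (?D x0 b) < e'"
    unfolding eventually_at by blast
  obtain d2 where d2: "d2 > 0" "ball x0 d2 \<subseteq> S"
    using S openE by blast
  define d where "d = min d1 d2"
  have sub: "ball x0 d \<subseteq> S" using d2 by (auto simp: d_def)
  have onorm: "onorm (\<lambda>h. ?D x h - ?D x0 h) \<le> e" if x: "x \<in> ball x0 d" for x
  proof (rule onorm_le)
    fix h
    have xS: "x \<in> S" using x sub by blast
    have "?D x h - ?D x0 h = (\<Sum>b\<in>Basis. (h \<bullet> b) *\<^sub>R (?D x b - ?D x0 b))"
      using frechet_derivative_eq_sum_Basis[OF diff[OF xS], of h]
        frechet_derivative_eq_sum_Basis[OF diff[OF S(2)], of h]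
      by (simp add: sum_subtractf scaleR_diff_right)
    also have "norm \<dots> \<le> (\<Sum>b\<in>(Basis::'a set). norm h * e')"
    proof (rule order_trans[OF norm_sum], rule sum_mono)
      fix b :: 'a assume b: "b \<in> Basis"
      have "norm (?D x b - ?D x0 b) \<le> e'"
        using d1(2)[of x b] x b \<open>e' > 0\<close>
        by (cases "x = x0") (auto simp: d_def dist_norm norm_minus_commute less_imp_le)
      then show "norm ((h \<bullet> b) *\<^sub>R (?D x b - ?D x0 b)) \<le> norm h * e'"
        using Basis_le_norm[OF b, of h] by (simp add: mult_mono)
    qed
    also have "\<dots> = e * norm h" by (simp add: e'_def)
    finally show "norm (?D x h - ?D x0 h) \<le> e * norm h" .
  qed
  have bl: "bounded_linear (?D x0)"
    using diff[OF S(2)] frechet_derivative_works has_derivative_bounded_linear by blast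
  show ?thesis
  proof (rule that)
    show "d > 0" using d1 d2 by (simp add: d_def)
    show "ball x0 d \<subseteq> S" by fact
    fix p q assume pq: "p \<in> ball x0 d" "q \<in> ball x0 d"
    have "norm ((f p - ?D x0 p) - (f q - ?D x0 q)) \<le> e * norm (p - q)"
    proof (rule differentiable_bound[OF convex_ball _ onorm])
      fix x assume "x \<in> ball x0 d"
      then have "x \<in> S" using sub by blast
      then show "((\<lambda>x. f x - ?D x0 x) has_derivative (\<lambda>h. ?D x h - ?D x0 h)) (at x within ball x0 d)"
        using diff frechet_derivative_works
        by (intro has_derivative_at_withinI[OF has_derivative_diff] bounded_linear_imp_has_derivative[OF bl]) blast
    qed (use pq in auto)
    then show "norm (f p - f q - ?D x0 (p - q)) \<le> e * norm (p - q)"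
      by (simp add: linear_diff[OF bounded_linear.linear[OF bl]] algebra_simps)
  qed
qed

text \<open>Strict differentiability with error 1 leaves the linear part, so 1 plus its operator
  norm is a Lipschitz constant.\<close>

lemma C1_locally_Lipschitz:
  fixes f :: "'a::euclidean_space \<Rightarrow> 'b::real_normed_vector"
  assumes S: "open S" "x0 \<in> S" and f: "Ck_on 1 S f"
  obtains L d where "L \<ge> 0" "d > 0" "ball x0 d \<subseteq> S"
    "\<And>p q. p \<in> ball x0 d \<Longrightarrow> q \<in> ball x0 d \<Longrightarrow> norm (f p - f q) \<le> L * norm (p - q)"
proof -
  let ?A = "frechet_derivative f (at x0)"
  obtain d where d: "d > 0" "ball x0 d \<subseteq> S"
    "\<And>p q. p \<in> ball x0 d \<Longrightarrow> q \<in> ball x0 d \<Longrightarrow> norm (f p - f q - ?A (p - q)) \<le> 1 * norm (p - q)"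
    using strict_derivative[OF S f, of 1] by auto
  have bl: "bounded_linear ?A"
    using f S frechet_derivative_works has_derivative_bounded_linear by fastforce
  show ?thesis
  proof (rule that[of "1 + onorm ?A" d])
    fix p q assume "p \<in> ball x0 d" "q \<in> ball x0 d"
    then have "norm (f p - f q - ?A (p - q)) \<le> norm (p - q)" using d(3) by simp
    moreover have "norm (?A (p - q)) \<le> onorm ?A * norm (p - q)" by (rule onorm[OF bl])
    moreover have "norm (f p - f q) \<le> norm (f p - f q - ?A (p - q)) + norm (?A (p - q))"
      by (metis add.commute norm_triangle_sub)
    ultimately show "norm (f p - f q) \<le> (1 + onorm ?A) * norm (p - q)"
      by (simp add: algebra_simps)
  qed (use d onorm_pos_le[OF bl] in auto)
qed

section \<open>Curves that stay close to a set\<close>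

text \<open>Says that \<open>x\<close> is a point of \<open>F\<close> nearest to
  \<open>x + \<nu>\<close>: the open ball about \<open>x + \<nu>\<close> that has \<open>x\<close>
  on its boundary misses \<open>F\<close>. This makes sense for an arbitrary set.\<close>

definition proximal_normal :: "'a::euclidean_space set \<Rightarrow> 'a \<Rightarrow> 'a \<Rightarrow> bool" where
  "proximal_normal F x \<nu> \<longleftrightarrow> x \<in> F \<and> (\<forall>p\<in>F. norm \<nu> \<le> dist p (x + \<nu>))"

text \<open>Equality instead of a one-sided inequality makes the condition linear: tangent fields
  can be added, scaled by functions and followed backwards.\<close>

definition tangent_field :: "'a::euclidean_space set \<Rightarrow> ('a \<Rightarrow> 'a) \<Rightarrow> bool" where
  "tangent_field F X \<longleftrightarrow> (\<forall>x \<nu>. proximal_normal F x \<nu> \<longrightarrow> X x \<bullet> \<nu> = 0)"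

lemma tangent_field_minus: "tangent_field F X \<Longrightarrow> tangent_field F (\<lambda>x. - X x)"
  by (simp add: tangent_field_def)

text \<open>The zeros of \<open>g - h\<close> form a compact set. If \<open>g T > h T\<close>, the
  intermediate value theorem yields a zero at or after every time with \<open>g \<le> h\<close>;
  applied to the time that \<open>step\<close> supplies after the last zero, this is a
  contradiction.\<close>

lemma continuous_no_upcrossing:
  fixes g h :: "real \<Rightarrow> real"
  assumes "0 \<le> T" "continuous_on {0..T} g" "continuous_on {0..T} h" "g 0 \<le> h 0"
    and step: "\<And>t. 0 \<le> t \<Longrightarrow> t < T \<Longrightarrow> g t = h t \<Longrightarrow> \<exists>s. t < s \<and> s \<le> T \<and> g s \<le> h s"
  shows "g T \<le> h T"
proof (rule ccontr)
  assume gT: "\<not> g T \<le> h T"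
  define k where "k = (\<lambda>t. g t - h t)"
  have cont: "continuous_on {0..T} k"
    unfolding k_def by (intro continuous_on_diff assms)
  define Z where "Z = {t\<in>{0..T}. k t = 0}"
  have zero: "\<exists>t. s \<le> t \<and> t \<le> T \<and> k t = 0" if "0 \<le> s" "s \<le> T" "g s \<le> h s" for s
    by (rule IVT'[of k s 0 T]) (use that gT continuous_on_subset[OF cont, of "{s..T}"] in \<open>auto simp: k_def\<close>)
  have ex: "\<exists>t\<in>Z. s \<le> t" if s: "0 \<le> s" "s \<le> T" "g s \<le> h s" for s
  proof -
    obtain t where "s \<le> t" "t \<le> T" "k t = 0" using zero[OF s] by auto
    then show ?thesis using s by (intro bexI[of _ t]) (auto simp: Z_def)
  qed
  have "closed Z"
    using continuous_closed_preimage_constant[OF cont] by (simp add: Z_def)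
  moreover have "bounded Z" by (rule bounded_subset[of "{0..T}"]) (auto simp: Z_def)
  moreover have "Z \<noteq> {}" using ex[of 0] assms by auto
  ultimately obtain t where t: "t \<in> Z" "\<And>s. s \<in> Z \<Longrightarrow> s \<le> t"
    using compact_attains_sup[of Z] by (auto simp: compact_eq_bounded_closed)
  then have "t \<noteq> T" "0 \<le> t" "t \<le> T" "g t = h t" using gT by (auto simp: Z_def k_def)
  then obtain s where "t < s" "s \<le> T" "g s \<le> h s" using step[of t] by auto
  then obtain s' where "s' \<in> Z" "s \<le> s'" using ex[of s] \<open>0 \<le> t\<close> by auto
  with t \<open>t < s\<close> show False by force
qed

text \<open>If \<open>q\<close> is a nearest point of \<open>F\<close> to \<open>\<gamma> t\<close>,
  then \<open>\<gamma> t - q\<close> is a proximal normal, hence orthogonal to \<open>X q\<close>,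
  and the distance \<delta> to \<open>F\<close> grows at rate at most
  \<open>L * \<delta> + e\<close>. For times with \<open>2 * L * T \<le> 1\<close> an affine
  comparison function replaces the exponential of Gronwall's lemma. The radii fit together: the
  curve stays within \<rho> of \<open>x0\<close>, its nearest points within 2\<rho>, and points of
  \<open>F\<close> beyond 3\<rho> are too far away to compete.\<close>

lemma approx_integral_curve_near:
  fixes X :: "'a::euclidean_space \<Rightarrow> 'a"
  assumes F: "closed (F \<inter> cball x0 (3 * \<rho>))" and x0: "x0 \<in> F" and "\<rho> \<ge> 0"
    and tan: "tangent_field F X"
    and Lip: "\<And>p q. p \<in> cball x0 (2 * \<rho>) \<Longrightarrow> q \<in> cball x0 (2 * \<rho>) \<Longrightarrow>
      norm (X p - X q) \<le> L * norm (p - q)" and "L \<ge> 0"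
    and \<gamma>: "\<And>t. t \<in> {0..T} \<Longrightarrow> \<gamma> t \<in> cball x0 \<rho>"
      "\<And>t. t \<in> {0..T} \<Longrightarrow> (\<gamma> has_vector_derivative \<gamma>' t) (at t within {0..T})"
      "\<And>t. t \<in> {0..T} \<Longrightarrow> norm (\<gamma>' t - X (\<gamma> t)) \<le> e"
    and start: "\<gamma> 0 \<in> F" and T: "0 \<le> T" "2 * L * T \<le> 1"
  shows "\<exists>q\<in>F. dist (\<gamma> T) q \<le> 2 * e * T"
proof -
  \<comment> \<open>The truncated set is closed, so nearest points exist; \<open>nearest\<close>
    shows that they are nearest in all of \<open>F\<close>.\<close>
  define G where "G = F \<inter> cball x0 (3 * \<rho>)"
  define \<delta> where "\<delta> t = infdist (\<gamma> t) G" for t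
  have "x0 \<in> G" using x0 \<open>\<rho> \<ge> 0\<close> by (simp add: G_def)
  have "closed G" using F by (simp add: G_def)
  have "e \<ge> 0" using order_trans[OF norm_ge_zero \<gamma>(3)[of 0]] T by simp
  have nearest: "\<exists>q\<in>F. dist (\<gamma> t) q = \<delta> t \<and> q \<in> cball x0 (2*\<rho>) \<and> proximal_normal F q (\<gamma> t - q)"
    if t: "t \<in> {0..T}" for t
  proof -
    obtain q where q: "q \<in> G" "\<delta> t = dist (\<gamma> t) q"
      using infdist_attains_inf[OF \<open>closed G\<close>, of "\<gamma> t"] \<open>x0 \<in> G\<close> by (auto simp: \<delta>_def)
    have g: "dist x0 (\<gamma> t) \<le> \<rho>" using \<gamma>(1)[OF t] by simp
    have le: "dist (\<gamma> t) q \<le> dist (\<gamma> t) p" if "p \<in> G" for p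
      using infdist_le[OF that, of "\<gamma> t"] q by (simp add: \<delta>_def)
    have rho: "dist (\<gamma> t) q \<le> \<rho>" using le[OF \<open>x0 \<in> G\<close>] g by (simp add: dist_commute)
    have "dist (\<gamma> t) q \<le> dist (\<gamma> t) p" if p: "p \<in> F" for p
    proof (cases "p \<in> G")
      case False
      then have "dist x0 p > 3 * \<rho>" using p by (simp add: G_def)
      moreover have "dist x0 p \<le> dist x0 (\<gamma> t) + dist (\<gamma> t) p" by (rule dist_triangle)
      ultimately show ?thesis using rho g \<open>\<rho> \<ge> 0\<close> by linarith
    qed (rule le)
    then have "proximal_normal F q (\<gamma> t - q)"
      using q by (auto simp: proximal_normal_def G_def dist_norm norm_minus_commute)
    moreover have "dist x0 q \<le> 2 * \<rho>"
      using dist_triangle[of x0 q "\<gamma> t"] g rho by linarith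
    ultimately show ?thesis using q by (auto simp: G_def)
  qed
  have cont\<gamma>: "continuous_on {0..T} \<gamma>"
    using has_vector_derivative_continuous[OF \<gamma>(2)] by (simp add: continuous_on_eq_continuous_within)
  have cont: "continuous_on {0..T} \<delta>"
    unfolding \<delta>_def by (intro continuous_on_infdist cont\<gamma>)
  \<comment> \<open>The positive \<open>\<kappa>\<close> makes the comparison function strictly
    steeper than the distance at a time of contact; it tends to 0 at the end.\<close>
  have main: "\<delta> T \<le> \<kappa> + (2 * (L * \<kappa> + e) + \<kappa>) * T" if \<kappa>: "\<kappa> > 0" for \<kappa>
  proof -
    define c where "c = 2 * (L * \<kappa> + e) + \<kappa>"
    have "c > 0" using \<kappa> \<open>L \<ge> 0\<close> \<open>e \<ge> 0\<close> by (simp add: c_def add_nonneg_pos)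
    show ?thesis unfolding c_def[symmetric]
    proof (rule continuous_no_upcrossing[of T \<delta> "\<lambda>t. \<kappa> + c * t"])
      show "\<delta> 0 \<le> \<kappa> + c * 0"
        using start \<gamma>(1)[of 0] T \<kappa> \<open>\<rho> \<ge> 0\<close> by (auto simp: \<delta>_def G_def)
      fix t assume t: "0 \<le> t" "t < T" "\<delta> t = \<kappa> + c * t"
      then have tI: "t \<in> {0..T}" by simp
      obtain q where q: "q \<in> F" "dist (\<gamma> t) q = \<delta> t" "q \<in> cball x0 (2*\<rho>)"
        "proximal_normal F q (\<gamma> t - q)" using nearest[OF tI] by blast
      have pos: "\<delta> t > 0" using t \<kappa> \<open>c > 0\<close> by (simp add: add_pos_nonneg)
      have nz: "\<gamma> t - q \<noteq> 0" using pos q(2) by auto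
      define l where "l = \<gamma>' t \<bullet> sgn (\<gamma> t - q) - c"
      \<comment> \<open>The distance to \<open>F\<close> need not be differentiable. The distance to
        the fixed point \<open>q\<close> is, it equals the former at time \<open>t\<close> and
        bounds it from above at other times.\<close>
      have der: "((\<lambda>s. norm (\<gamma> s - q) - (\<kappa> + c * s)) has_real_derivative l) (at t within {0..T})"
      proof -
        have "((\<lambda>s. \<gamma> s - q) has_derivative (\<lambda>h. h *\<^sub>R \<gamma>' t)) (at t within {0..T})"
          using has_derivative_diff[OF \<gamma>(2)[OF tI, unfolded has_vector_derivative_def] has_derivative_const]
          by simp
        from has_derivative_compose[OF this has_derivative_norm[OF nz]]
        have "((\<lambda>s. norm (\<gamma> s - q)) has_real_derivative (\<gamma>' t \<bullet> sgn (\<gamma> t - q))) (at t within {0..T})"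
          by (simp add: has_field_derivative_def inner_commute mult.commute[of _ "_ \<bullet> _"])
        then show ?thesis unfolding l_def
          by (auto intro!: derivative_eq_intros)
      qed
      \<comment> \<open>Tangency at \<open>q\<close> gives
        \<open>X q \<bullet> (\<gamma> t - q) = 0\<close>, so \<open>X q\<close> may be
        subtracted.\<close>
      have "\<gamma>' t \<bullet> (\<gamma> t - q) = (\<gamma>' t - X (\<gamma> t)) \<bullet> (\<gamma> t - q) + (X (\<gamma> t) - X q) \<bullet> (\<gamma> t - q)"
        using q(4) tan by (simp add: tangent_field_def inner_diff_left)
      also have "\<dots> \<le> e * \<delta> t + (L * \<delta> t) * \<delta> t"
      proof (rule add_mono)
        show "(\<gamma>' t - X (\<gamma> t)) \<bullet> (\<gamma> t - q) \<le> e * \<delta> t"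
          using \<gamma>(3)[OF tI] q(2) pos
          by (intro order_trans[OF norm_cauchy_schwarz] mult_mono) (auto simp: dist_norm \<open>e \<ge> 0\<close>)
        have "norm (X (\<gamma> t) - X q) \<le> L * \<delta> t"
          using Lip[of "\<gamma> t" q] \<gamma>(1)[OF tI] q \<open>\<rho> \<ge> 0\<close> by (simp add: dist_norm)
        then show "(X (\<gamma> t) - X q) \<bullet> (\<gamma> t - q) \<le> (L * \<delta> t) * \<delta> t"
          using q(2) pos \<open>L \<ge> 0\<close>
          by (intro order_trans[OF norm_cauchy_schwarz] mult_mono) (auto simp: dist_norm)
      qed
      finally have "\<gamma>' t \<bullet> (\<gamma> t - q) \<le> (e + L * \<delta> t) * \<delta> t" by (simp add: algebra_simps)
      then have "\<gamma>' t \<bullet> sgn (\<gamma> t - q) \<le> e + L * \<delta> t"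
        using pos q(2) by (simp add: sgn_div_norm dist_norm inverse_eq_divide pos_divide_le_eq)
      \<comment> \<open>The short time span enters here: \<open>2 * L * t \<le> 1\<close> bounds
        \<open>L * (c * t)\<close> by \<open>c / 2\<close>, and the choice of \<open>c\<close> then
        leaves \<open>l\<close> at most \<open>- \<kappa> / 2\<close>.\<close>
      also have "L * \<delta> t \<le> L * \<kappa> + c / 2"
      proof -
        have "2 * L * t \<le> 1" using T t \<open>L \<ge> 0\<close> by (smt (verit) mult_left_mono)
        then have "c * (2 * L * t) \<le> c" using \<open>c > 0\<close> by (simp add: mult_left_le)
        then show ?thesis using t(3) by (simp add: algebra_simps)
      qed
      finally have "l < 0" using \<kappa> by (simp add: l_def c_def field_simps)
      from has_real_derivative_neg_dec_right[OF der this]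
      obtain d where d: "d > 0" "\<And>h. h > 0 \<Longrightarrow> t + h \<in> {0..T} \<Longrightarrow> h < d \<Longrightarrow>
        norm (\<gamma> (t + h) - q) - (\<kappa> + c * (t + h)) < norm (\<gamma> t - q) - (\<kappa> + c * t)"
        by blast
      define h where "h = min (d / 2) (T - t)"
      have h: "0 < h" "h < d" "t + h \<in> {0..T}" using d(1) t by (auto simp: h_def)
      define s where "s = t + h"
      have s: "t < s" "s \<le> T" using h by (auto simp: s_def)
      have "norm (\<gamma> s - q) < \<kappa> + c * s"
        using d(2)[OF h(1,3,2)] t(3) q(2) unfolding s_def dist_norm by linarith
      moreover have "\<delta> s \<le> norm (\<gamma> s - q)"
      proof -
        have "q \<in> G" using q \<open>\<rho> \<ge> 0\<close> by (simp add: G_def)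
        then show ?thesis using infdist_le[of q G "\<gamma> s"] by (simp add: \<delta>_def dist_norm)
      qed
      ultimately show "\<exists>s>t. s \<le> T \<and> \<delta> s \<le> \<kappa> + c * s" using s by (intro exI[of _ s]) auto
    qed (use T cont in \<open>auto intro!: continuous_intros\<close>)
  qed
  have "\<delta> T \<le> 2 * e * T"
  proof (rule field_le_epsilon)
    fix \<epsilon> :: real assume "\<epsilon> > 0"
    \<comment> \<open>\<open>N\<close> is the total coefficient of \<open>\<kappa>\<close> in the
      bound \<open>main\<close>.\<close>
    define N where "N = 1 + 2 * L * T + T"
    have "N > 0" using T \<open>L \<ge> 0\<close> by (simp add: N_def add_pos_nonneg)
    define \<kappa> where "\<kappa> = \<epsilon> / N"
    have "\<kappa> > 0" "\<kappa> * N = \<epsilon>" using \<open>\<epsilon> > 0\<close> \<open>N > 0\<close> by (auto simp: \<kappa>_def)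
    then show "\<delta> T \<le> 2 * e * T + \<epsilon>"
      using main[of \<kappa>] by (simp add: N_def algebra_simps)
  qed
  moreover obtain q where "q \<in> F" "dist (\<gamma> T) q = \<delta> T" using nearest[of T] T by auto
  ultimately show ?thesis by (intro bexI[of _ q]) auto
qed

section \<open>Second order displacements inside a set\<close>

lemma closed_Int_cball:
  assumes "closedin (top_of_set S) F" "cball x r \<subseteq> S"
  shows "closed (F \<inter> cball x r)"
proof -
  obtain C where "closed C" "F = S \<inter> C" using assms(1) by (auto simp: closedin_closed)
  then have "F \<inter> cball x r = C \<inter> cball x r" using assms(2) by auto
  then show ?thesis using \<open>closed C\<close> by (simp add: closed_Int)
qed

text \<open>Expresses that \<open>F\<close> contains points \<open>x + s u + s^2 w + o(s^2)\<close>
  as \<open>s\<close> decreases to 0. These points are chosen for each \<open>s\<close> separately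
  and need not form a curve.\<close>

definition second_order_reach :: "'a::euclidean_space set \<Rightarrow> 'a \<Rightarrow> 'a \<Rightarrow> 'a \<Rightarrow> bool" where
  "second_order_reach F x u w \<longleftrightarrow> (\<forall>\<epsilon>>0. \<forall>\<^sub>F s in at_right 0.
     \<exists>p\<in>F. norm (p - (x + s *\<^sub>R u + s\<^sup>2 *\<^sub>R w)) \<le> \<epsilon> * s\<^sup>2)"

text \<open>Start at a point \<open>p\<close> of \<open>F\<close> within o(s^2) of
  \<open>x0 + s u + s^2 w\<close> and follow, for time \<open>s\<close>, a quadratic approximation
  of the integral curve of \<open>X\<close> through \<open>p\<close>. Its velocity misses
  \<open>X\<close> by o(s), so it ends within o(s^2) of \<open>F\<close>. Substituting
  \<open>X p = V + s A u + o(s)\<close> gives the new coefficients.\<close>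

lemma second_order_reach_step:
  fixes X :: "'a::euclidean_space \<Rightarrow> 'a"
  assumes \<Omega>: "open \<Omega>" and F: "closedin (top_of_set \<Omega>) F" "x0 \<in> F"
    and X: "Ck_on 1 \<Omega> X" "tangent_field F X" and reach: "second_order_reach F x0 u w"
  defines "A \<equiv> frechet_derivative X (at x0)" and "V \<equiv> X x0"
  shows "second_order_reach F x0 (u + V) (w + A u + (1/2) *\<^sub>R A V)"
  unfolding second_order_reach_def
proof (intro allI impI)
  fix \<epsilon> :: real assume "\<epsilon> > 0"
  have x0: "x0 \<in> \<Omega>" using F closedin_imp_subset by blast
  have bl: "bounded_linear A"
    unfolding A_def using Ck_on_has_derivative[of 0 \<Omega> X x0] X x0 has_derivative_bounded_linear by simp
  note A_lin = linear_diff[OF bounded_linear.linear[OF bl]] linear_add[OF bounded_linear.linear[OF bl]]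
    linear_scale[OF bounded_linear.linear[OF bl]]
  define N where "N = onorm A"
  have N: "norm (A h) \<le> N * norm h" "N \<ge> 0" for h
    using onorm[OF bl] onorm_pos_le[OF bl] by (auto simp: N_def)
  \<comment> \<open>The constants are bounds to come: \<open>norm (p - x0) \<le> s * C1\<close>,
    \<open>norm (X p) \<le> CX\<close> and
    \<open>norm (\<gamma> t - p) \<le> t * C2\<close>.\<close>
  define C1 where "C1 = norm u + norm w + 1"
  define CX where "CX = norm V + (N + 1) * C1"
  define C2 where "C2 = CX + N * norm V"
  have C: "C1 \<ge> 0" "CX \<ge> 0" "C2 \<ge> 0" using N(2) by (auto simp: C1_def CX_def C2_def)
  \<comment> \<open>The errors collected at the end add up to
    \<open>\<eta> * (C1 + 2 * C2 + 4)\<close> times s^2. The bound \<open>\<eta> \<le> 1\<close>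
    makes \<open>N + 1\<close> a Lipschitz constant of \<open>X\<close>.\<close>
  define \<eta> where "\<eta> = min 1 (\<epsilon> / (C1 + 2 * C2 + 4))"
  have \<eta>: "\<eta> > 0" "\<eta> \<le> 1" "\<eta> * (C1 + 2 * C2 + 4) \<le> \<epsilon>"
    using \<open>\<epsilon> > 0\<close> C by (auto simp: \<eta>_def min_def field_simps add_nonneg_pos add_pos_nonneg)
  obtain d where d: "d > 0" "ball x0 d \<subseteq> \<Omega>"
    "\<And>p q. p \<in> ball x0 d \<Longrightarrow> q \<in> ball x0 d \<Longrightarrow> norm (X p - X q - A (p - q)) \<le> \<eta> * norm (p - q)"
    using strict_derivative[OF \<Omega> x0 X(1) \<eta>(1)] unfolding A_def by blast
  have Lip: "norm (X p - X q) \<le> (N + 1) * norm (p - q)" if "p \<in> ball x0 d" "q \<in> ball x0 d" for p q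
  proof -
    have "norm (X p - X q) \<le> norm (X p - X q - A (p - q)) + norm (A (p - q))"
      by (metis add.commute norm_triangle_sub)
    also have "\<dots> \<le> \<eta> * norm (p - q) + N * norm (p - q)"
      by (intro add_mono d that N)
    also have "\<dots> \<le> (N + 1) * norm (p - q)"
      using mult_right_mono[OF \<eta>(2), of "norm (p - q)"] by (simp add: algebra_simps)
    finally show ?thesis .
  qed
  define \<rho> where "\<rho> = d / 4"
  have \<rho>: "\<rho> > 0" "3 * \<rho> < d" using d by (auto simp: \<rho>_def)
  \<comment> \<open>Each summand yields one condition on \<open>s < 1 / K\<close>:
    \<open>s \<le> 1\<close>; the arc stays within \<rho> of \<open>x0\<close>; the time span is
    admissible for the Lipschitz constant \<open>N + 1\<close>; the quadratic remainders in the
    velocity and in the endpoint are at most \<open>\<eta> * s\<close>.\<close>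
  define K where "K = 1 + (C1 + C2) / \<rho> + 2 * (N + 1) + (N * (N + 1) * C1 + N * N * norm V) / \<eta>
     + N * (norm w + 1) / \<eta>"
  have terms: "0 \<le> (C1 + C2) / \<rho>" "0 \<le> 2 * (N + 1)" "0 \<le> (N * (N + 1) * C1 + N * N * norm V) / \<eta>"
    "0 \<le> N * (norm w + 1) / \<eta>"
    using C N(2) \<rho> \<eta> by auto
  then have "K > 0" by (simp add: K_def)
  then have "\<forall>\<^sub>F s in at_right 0. s \<in> {0<..<1 / K}"
    by (intro eventually_at_right_real) simp
  moreover have "\<forall>\<^sub>F s in at_right 0. \<exists>p\<in>F. norm (p - (x0 + s *\<^sub>R u + s\<^sup>2 *\<^sub>R w)) \<le> \<eta> * s\<^sup>2"
    using reach \<eta> by (simp add: second_order_reach_def)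
  ultimately show "\<forall>\<^sub>F s in at_right 0. \<exists>p\<in>F.
    norm (p - (x0 + s *\<^sub>R (u + V) + s\<^sup>2 *\<^sub>R (w + A u + (1/2) *\<^sub>R A V))) \<le> \<epsilon> * s\<^sup>2"
  proof eventually_elim
    case (elim s)
    then have s: "s > 0" "s * K < 1" using \<open>K > 0\<close> by (auto simp: field_simps)
    have small: "s * k \<le> 1" if "k \<le> K" for k
      using mult_left_mono[OF that, of s] s by linarith
    have s1: "s \<le> 1" using small[of 1] terms by (simp add: K_def)
    have "s * ((C1 + C2) / \<rho>) \<le> 1"
      using terms by (intro small) (simp add: K_def)
    then have s2: "s * (C1 + C2) \<le> \<rho>" using \<rho> by (simp add: pos_divide_le_eq)
    have s3: "2 * (N + 1) * s \<le> 1"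
      using small[of "2 * (N + 1)"] terms by (simp add: K_def mult.commute)
    have "s * ((N * (N + 1) * C1 + N * N * norm V) / \<eta>) \<le> 1"
      using terms by (intro small) (simp add: K_def)
    then have s4: "s * (N * (N + 1) * C1 + N * N * norm V) \<le> \<eta>" using \<eta> by (simp add: pos_divide_le_eq)
    have "s * (N * (norm w + 1) / \<eta>) \<le> 1"
      using terms by (intro small) (simp add: K_def)
    then have s5: "s * (N * (norm w + 1)) \<le> \<eta>" using \<eta> by (simp add: pos_divide_le_eq)
    have sq: "s\<^sup>2 \<le> s" using s s1 by (simp add: power2_eq_square mult_left_le)
    obtain p where p: "p \<in> F" and r: "norm (p - (x0 + s *\<^sub>R u + s\<^sup>2 *\<^sub>R w)) \<le> \<eta> * s\<^sup>2"
      using elim by blast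
    define r where "r = p - (x0 + s *\<^sub>R u + s\<^sup>2 *\<^sub>R w)"
    have nr: "norm r \<le> \<eta> * s\<^sup>2" using r by (simp add: r_def)
    have "\<eta> * s\<^sup>2 \<le> 1 * s" by (intro mult_mono) (use \<eta> sq in auto)
    then have nr': "norm r \<le> s" using nr by simp
    have px: "norm (p - x0) \<le> s * C1"
    proof -
      have "p - x0 = r + s *\<^sub>R u + s\<^sup>2 *\<^sub>R w" by (simp add: r_def)
      also have "norm \<dots> \<le> norm r + norm (s *\<^sub>R u) + norm (s\<^sup>2 *\<^sub>R w)"
        by (intro order_trans[OF norm_triangle_ineq] add_right_mono norm_triangle_ineq)
      also have "\<dots> \<le> s + s * norm u + s * norm w"
        using nr' s sq by (intro add_mono) (auto intro: mult_right_mono)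
      finally show ?thesis by (simp add: C1_def algebra_simps)
    qed
    have "s * C1 \<le> s * (C1 + C2)" using C s by simp
    then have pball: "p \<in> ball x0 d"
      using px s2 \<rho> by (simp add: dist_norm norm_minus_commute)
    have XpV: "norm (X p - V) \<le> (N + 1) * (s * C1)"
      unfolding V_def using N(2) px \<open>d > 0\<close>
      by (intro order_trans[OF Lip[OF pball]] mult_left_mono) auto
    have Xp: "norm (X p) \<le> CX"
    proof -
      have "(N + 1) * (s * C1) \<le> (N + 1) * (1 * C1)"
        using N(2) s1 s C by (intro mult_left_mono mult_right_mono) auto
      then show ?thesis using XpV norm_triangle_sub[of "X p" V] by (simp add: CX_def)
    qed
    \<comment> \<open>The Taylor polynomial of the integral curve through \<open>p\<close>, but with
      its second order coefficient \<open>A V\<close> taken at \<open>x0\<close> instead of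
      \<open>p\<close>.\<close>
    define \<gamma> where "\<gamma> t = p + t *\<^sub>R X p + (t\<^sup>2 / 2) *\<^sub>R A V" for t
    have AV: "norm (A V) \<le> N * norm V" by (rule N)
    have half: "t\<^sup>2 / 2 \<le> t" "t\<^sup>2 / 2 \<ge> 0" "t\<^sup>2 / 2 \<le> s * s" if "t \<in> {0..s}" for t
    proof -
      have "t\<^sup>2 \<le> t * 1" unfolding power2_eq_square using that s1 by (intro mult_left_mono) auto
      then show "t\<^sup>2 / 2 \<le> t" using that by auto
      have "t\<^sup>2 \<le> s\<^sup>2" using that by (intro power_mono) auto
      then show "t\<^sup>2 / 2 \<le> s * s" unfolding power2_eq_square using zero_le_square[of s] by linarith
    qed simp
    have \<gamma>p: "norm (\<gamma> t - p) \<le> t * C2" if t: "t \<in> {0..s}" for t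
    proof -
      have t0: "t \<ge> 0" using t by simp
      have "norm (\<gamma> t - p) \<le> norm (t *\<^sub>R X p) + norm ((t\<^sup>2 / 2) *\<^sub>R A V)"
        using norm_triangle_ineq[of "t *\<^sub>R X p" "(t\<^sup>2 / 2) *\<^sub>R A V"] by (simp add: \<gamma>_def del: norm_scaleR)
      also have "\<dots> = t * norm (X p) + t\<^sup>2 / 2 * norm (A V)" using t by simp
      also have "\<dots> \<le> t * CX + t * (N * norm V)"
        using half[OF t] Xp AV t0 by (intro add_mono mult_mono) (auto simp: t0)
      finally show ?thesis by (simp add: C2_def algebra_simps)
    qed
    have \<gamma>x: "norm (\<gamma> t - x0) \<le> \<rho>" if t: "t \<in> {0..s}" for t
    proof -
      have "norm (\<gamma> t - x0) \<le> norm (\<gamma> t - p) + norm (p - x0)"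
        by (metis diff_add_cancel add_diff_eq norm_triangle_ineq)
      also have "\<dots> \<le> s * C2 + s * C1"
        using \<gamma>p[OF t] px t C mult_right_mono[of t s C2] by auto
      finally show ?thesis using s2 by (simp add: algebra_simps)
    qed
    have "\<exists>q\<in>F. dist (\<gamma> s) q \<le> 2 * (s * (\<eta> * (C2 + 1))) * s"
    proof (rule approx_integral_curve_near[where \<rho>=\<rho> and L="N + 1" and \<gamma>'="\<lambda>t. X p + t *\<^sub>R A V"])
      show "closed (F \<inter> cball x0 (3 * \<rho>))"
      proof (rule closed_Int_cball[OF F(1)])
        have "cball x0 (3 * \<rho>) \<subseteq> ball x0 d" using \<rho> by auto
        then show "cball x0 (3 * \<rho>) \<subseteq> \<Omega>" using d(2) by blast
      qed
      show "norm (X p - X q) \<le> (N + 1) * norm (p - q)"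
        if "p \<in> cball x0 (2 * \<rho>)" "q \<in> cball x0 (2 * \<rho>)" for p q
        using that \<rho> by (intro Lip) auto
      show "\<gamma> t \<in> cball x0 \<rho>" if "t \<in> {0..s}" for t
        using \<gamma>x[OF that] by (simp add: dist_norm norm_minus_commute)
      show "(\<gamma> has_vector_derivative X p + t *\<^sub>R A V) (at t within {0..s})" for t
      proof -
        have "((\<lambda>t. t\<^sup>2 / 2) has_real_derivative t) (at t within {0..s})"
          by (auto intro!: derivative_eq_intros)
        from has_vector_derivative_scaleR[OF this has_vector_derivative_const[of "A V"]]
        have "((\<lambda>t. (t\<^sup>2 / 2) *\<^sub>R A V) has_vector_derivative t *\<^sub>R A V) (at t within {0..s})" by simp
        moreover have "((\<lambda>t. p + t *\<^sub>R X p) has_vector_derivative X p) (at t within {0..s})"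
          by (auto intro!: derivative_eq_intros)
        ultimately show ?thesis unfolding \<gamma>_def by (rule has_vector_derivative_add[rotated])
      qed
      show "norm (X p + t *\<^sub>R A V - X (\<gamma> t)) \<le> s * (\<eta> * (C2 + 1))" if t: "t \<in> {0..s}" for t
      proof -
        \<comment> \<open>Three errors: linearizing \<open>X\<close> between \<open>p\<close> and
          \<open>\<gamma> t\<close>, using \<open>A V\<close> in place of \<open>A (X p)\<close>,
          and the quadratic part of the arc.\<close>
        have "X p + t *\<^sub>R A V - X (\<gamma> t) =
          - (X (\<gamma> t) - X p - A (\<gamma> t - p)) + t *\<^sub>R A (V - X p) - (t\<^sup>2 / 2) *\<^sub>R A (A V)"
          by (simp add: \<gamma>_def A_lin algebra_simps)
        also have "norm \<dots> \<le> norm (X (\<gamma> t) - X p - A (\<gamma> t - p)) + norm (t *\<^sub>R A (V - X p))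
            + norm ((t\<^sup>2 / 2) *\<^sub>R A (A V))"
          by (smt (verit) norm_triangle_ineq4 norm_triangle_ineq norm_minus_cancel)
        also have "\<dots> \<le> \<eta> * (s * C2) + s * (N * ((N + 1) * (s * C1))) + s * s * (N * (N * norm V))"
        proof (intro add_mono)
          have "\<gamma> t \<in> ball x0 d" using \<gamma>x[OF t] \<rho> by (simp add: dist_norm norm_minus_commute)
          from d(3)[OF this pball]
          have "norm (X (\<gamma> t) - X p - A (\<gamma> t - p)) \<le> \<eta> * norm (\<gamma> t - p)" .
          also have "\<dots> \<le> \<eta> * (s * C2)"
            using \<gamma>p[OF t] t C mult_right_mono[of t s C2] \<eta> by (intro mult_left_mono) auto
          finally show "norm (X (\<gamma> t) - X p - A (\<gamma> t - p)) \<le> \<eta> * (s * C2)" .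
          have "norm (A (V - X p)) \<le> N * ((N + 1) * (s * C1))"
            using XpV N by (intro order_trans[OF N(1)] mult_left_mono) (auto simp: norm_minus_commute)
          then have "t * norm (A (V - X p)) \<le> s * (N * ((N + 1) * (s * C1)))"
            using t by (intro mult_mono) auto
          then show "norm (t *\<^sub>R A (V - X p)) \<le> s * (N * ((N + 1) * (s * C1)))" using t by simp
          have "norm (A (A V)) \<le> N * (N * norm V)"
            using AV N by (intro order_trans[OF N(1)] mult_left_mono) auto
          then have "t\<^sup>2 / 2 * norm (A (A V)) \<le> s * s * (N * (N * norm V))"
            using half[OF t] by (intro mult_mono) auto
          then show "norm ((t\<^sup>2 / 2) *\<^sub>R A (A V)) \<le> s * s * (N * (N * norm V))" by simp
        qed
        also have "\<dots> = \<eta> * (s * C2) + s * (s * (N * (N + 1) * C1 + N * N * norm V))"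
          by (simp add: algebra_simps)
        also have "\<dots> \<le> \<eta> * (s * C2) + s * \<eta>"
          using s4 s by simp
        finally show ?thesis by (simp add: algebra_simps)
      qed
    qed (use F(2) X(2) N(2) \<rho>(1) p s(1) s3 in \<open>auto simp: \<gamma>_def\<close>)
    then obtain q where q: "q \<in> F" "norm (q - \<gamma> s) \<le> 2 * (s * (\<eta> * (C2 + 1))) * s"
      by (auto simp: dist_norm norm_minus_commute)
    \<comment> \<open>Four errors: projecting the endpoint to \<open>F\<close>, the offset
      \<open>r\<close> of \<open>p\<close>, linearizing \<open>X\<close> at \<open>x0\<close>, and
      replacing \<open>A (p - x0)\<close> by \<open>s A u\<close>.\<close>
    have "q - (x0 + s *\<^sub>R (u + V) + s\<^sup>2 *\<^sub>R (w + A u + (1/2) *\<^sub>R A V)) =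
       (q - \<gamma> s) + r + s *\<^sub>R (X p - V - A (p - x0)) + s *\<^sub>R A (r + s\<^sup>2 *\<^sub>R w)"
      by (simp add: \<gamma>_def r_def A_lin algebra_simps power2_eq_square)
    also have "norm \<dots> \<le> norm (q - \<gamma> s) + norm r + norm (s *\<^sub>R (X p - V - A (p - x0))) + norm (s *\<^sub>R A (r + s\<^sup>2 *\<^sub>R w))"
      by (intro order_trans[OF norm_triangle_ineq] add_right_mono norm_triangle_ineq)
    also have "\<dots> \<le> 2 * (s * (\<eta> * (C2 + 1))) * s + \<eta> * s\<^sup>2 + s * (\<eta> * (s * C1)) + s * (s * \<eta>)"
    proof (intro add_mono q nr)
      have "norm (X p - V - A (p - x0)) \<le> \<eta> * (s * C1)"
        unfolding V_def using d(3)[OF pball, of x0] \<open>d > 0\<close> px \<eta>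
        by (intro order_trans[OF d(3)[OF pball]] mult_left_mono) auto
      then show "norm (s *\<^sub>R (X p - V - A (p - x0))) \<le> s * (\<eta> * (s * C1))" using s by simp
      have "norm (r + s\<^sup>2 *\<^sub>R w) \<le> norm r + s\<^sup>2 * norm w"
        by (metis norm_triangle_ineq norm_scaleR abs_of_nonneg zero_le_power2)
      also have "\<dots> \<le> s\<^sup>2 + s\<^sup>2 * norm w"
        using nr mult_right_mono[OF \<eta>(2), of "s\<^sup>2"] by simp
      finally have "norm (A (r + s\<^sup>2 *\<^sub>R w)) \<le> N * (s\<^sup>2 * (norm w + 1))"
        using N by (intro order_trans[OF N(1)] mult_left_mono) (auto simp: algebra_simps)
      also have "\<dots> = s * (s * (N * (norm w + 1)))" by (simp add: power2_eq_square)
      also have "\<dots> \<le> s * \<eta>" using s5 s by (intro mult_left_mono) auto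
      finally show "norm (s *\<^sub>R A (r + s\<^sup>2 *\<^sub>R w)) \<le> s * (s * \<eta>)" using s by simp
    qed
    also have "\<dots> = \<eta> * (C1 + 2 * C2 + 4) * s\<^sup>2"
      by (simp add: algebra_simps power2_eq_square)
    also have "\<dots> \<le> \<epsilon> * s\<^sup>2" using \<eta>(3) by (intro mult_right_mono) auto
    finally show ?case using q by blast
  qed
qed

section \<open>Brackets and integral curves of tangent fields\<close>

lemma second_order_reach_zero: "x \<in> F \<Longrightarrow> second_order_reach F x 0 0"
  unfolding second_order_reach_def by (auto intro!: always_eventually bexI[of _ x])

text \<open>For \<open>z = p - x\<close> with \<open>p\<close> in \<open>F\<close>, proximality
  amounts to \<open>2 * (z \<bullet> \<nu>) \<le> (norm z)\<^sup>2\<close>. With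
  \<open>z = s^2 w + o(s^2)\<close> the left side has order s^2 and the right side order s^4, so
  \<open>w\<close> cannot point towards \<open>\<nu>\<close>.\<close>

lemma second_order_reach_normal:
  assumes "second_order_reach F x 0 w" "proximal_normal F x \<nu>"
  shows "w \<bullet> \<nu> \<le> 0"
proof (rule ccontr)
  define c where "c = w \<bullet> \<nu>"
  assume "\<not> w \<bullet> \<nu> \<le> 0"
  then have "c > 0" by (simp add: c_def)
  then have "norm \<nu> > 0" by (auto simp: c_def)
  \<comment> \<open>With this tolerance the error in \<open>z\<close> costs at most half of the main
    term \<open>s^2 c\<close>.\<close>
  define \<epsilon> where "\<epsilon> = c / (2 * norm \<nu>)"
  have "\<epsilon> > 0" using \<open>c > 0\<close> \<open>norm \<nu> > 0\<close> by (simp add: \<epsilon>_def)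
  define B where "B = (norm w + \<epsilon>)\<^sup>2"
  have "B \<ge> 0" by (simp add: B_def)
  \<comment> \<open>For \<open>s < b\<close> both \<open>s \<le> 1\<close> and
    \<open>s * (B + 1) < c\<close> hold, hence \<open>s\<^sup>2 * B < c\<close>.\<close>
  define b where "b = min 1 (c / (B + 1))"
  have "b > 0" using \<open>c > 0\<close> \<open>B \<ge> 0\<close> by (simp add: b_def)
  then have "\<forall>\<^sub>F s in at_right 0. s \<in> {0<..<b}" by (rule eventually_at_right_real)
  moreover have "\<forall>\<^sub>F s in at_right 0. \<exists>p\<in>F. norm (p - (x + s *\<^sub>R 0 + s\<^sup>2 *\<^sub>R w)) \<le> \<epsilon> * s\<^sup>2"
    using assms(1) \<open>\<epsilon> > 0\<close> unfolding second_order_reach_def by blast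
  ultimately have "\<forall>\<^sub>F s in at_right 0. s \<in> {0<..<b} \<and> (\<exists>p\<in>F. norm (p - (x + s *\<^sub>R 0 + s\<^sup>2 *\<^sub>R w)) \<le> \<epsilon> * s\<^sup>2)"
    by (rule eventually_conj)
  then obtain s p where s: "s > 0" "s < b" and p: "p \<in> F" "norm (p - (x + s\<^sup>2 *\<^sub>R w)) \<le> \<epsilon> * s\<^sup>2"
    using eventually_happens'[OF trivial_limit_at_right_real] by force
  define z where "z = p - x"
  define r where "r = p - (x + s\<^sup>2 *\<^sub>R w)"
  have z: "z = s\<^sup>2 *\<^sub>R w + r" by (simp add: z_def r_def)
  have "norm \<nu> \<le> norm (z - \<nu>)"
    using assms(2) p(1) by (auto simp: proximal_normal_def dist_norm z_def algebra_simps)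
  then have "(norm \<nu>)\<^sup>2 \<le> (norm (z - \<nu>))\<^sup>2" by (intro power_mono) auto
  then have 1: "2 * (z \<bullet> \<nu>) \<le> (norm z)\<^sup>2"
    by (simp add: power2_norm_eq_inner inner_diff_left inner_diff_right inner_commute)
  have "norm z \<le> norm (s\<^sup>2 *\<^sub>R w) + norm r" unfolding z by (rule norm_triangle_ineq)
  also have "\<dots> \<le> s\<^sup>2 * (norm w + \<epsilon>)" using p(2) by (simp add: r_def algebra_simps)
  finally have "(norm z)\<^sup>2 \<le> (s\<^sup>2 * (norm w + \<epsilon>))\<^sup>2" by (intro power_mono) auto
  then have 2: "(norm z)\<^sup>2 \<le> s\<^sup>2 * (s\<^sup>2 * B)" by (simp add: B_def power2_eq_square mult.assoc mult.left_commute)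
  have "- (r \<bullet> \<nu>) \<le> norm r * norm \<nu>"
    using norm_cauchy_schwarz[of "- r" \<nu>] by simp
  also have "\<dots> \<le> \<epsilon> * s\<^sup>2 * norm \<nu>" using p(2) by (intro mult_right_mono) (auto simp: r_def)
  also have "\<dots> = s\<^sup>2 * c / 2" using \<open>norm \<nu> > 0\<close> by (simp add: \<epsilon>_def)
  finally have "s\<^sup>2 * c / 2 \<le> z \<bullet> \<nu>" by (simp add: z inner_add_left c_def algebra_simps)
  with 1 2 have "s\<^sup>2 * c \<le> s\<^sup>2 * (s\<^sup>2 * B)" by linarith
  then have "c \<le> s\<^sup>2 * B" by (rule mult_left_le_imp_le) (use s in simp)
  also have "s\<^sup>2 * B \<le> s * B"
    using s \<open>B \<ge> 0\<close> by (intro mult_right_mono) (auto simp: power2_eq_square b_def mult_left_le)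
  also have "\<dots> \<le> s * (B + 1)" using s by simp
  also have "\<dots> < c" using s \<open>B \<ge> 0\<close> by (simp add: b_def field_simps)
  finally show False by simp
qed

text \<open>Four legs along \<open>X\<close>, \<open>Y\<close>, \<open>-X\<close>, \<open>-Y\<close>
  take the first order displacement through \<open>X x\<close>, \<open>X x + Y x\<close>,
  \<open>Y x\<close> back to 0. In the second order term the contributions \<open>A (X x)\<close>
  and \<open>B (Y x)\<close> cancel and the bracket \<open>B (X x) - A (Y x)\<close>
  remains.\<close>

lemma proximal_normal_bracket_le:
  fixes X Y :: "'a::euclidean_space \<Rightarrow> 'a"
  assumes \<Omega>: "open \<Omega>" and F: "closedin (top_of_set \<Omega>) F"
    and X: "Ck_on 1 \<Omega> X" "tangent_field F X" and Y: "Ck_on 1 \<Omega> Y" "tangent_field F Y"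
    and \<nu>: "proximal_normal F x \<nu>"
  shows "(frechet_derivative Y (at x) (X x) - frechet_derivative X (at x) (Y x)) \<bullet> \<nu> \<le> 0"
proof -
  define A where "A = frechet_derivative X (at x)"
  define B where "B = frechet_derivative Y (at x)"
  have xF: "x \<in> F" using \<nu> by (simp add: proximal_normal_def)
  then have x: "x \<in> \<Omega>" using F closedin_imp_subset by blast
  have A: "(X has_derivative A) (at x)" and B: "(Y has_derivative B) (at x)"
    using X(1) Y(1) x Ck_on_has_derivative[of 0 \<Omega>] by (auto simp: A_def B_def)
  note lin = linear_add linear_diff linear_neg linear_scale linear_0
  note A_lin = lin[OF has_derivative_linear[OF A]] and B_lin = lin[OF has_derivative_linear[OF B]]
  have A': "frechet_derivative (\<lambda>x. - X x) (at x) = (\<lambda>h. - A h)"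
    using frechet_derivative_at[OF has_derivative_minus[OF A]] by simp
  have B': "frechet_derivative (\<lambda>x. - Y x) (at x) = (\<lambda>h. - B h)"
    using frechet_derivative_at[OF has_derivative_minus[OF B]] by simp
  have half: "(1/2) *\<^sub>R v + (1/2) *\<^sub>R v = v" "(1/2) *\<^sub>R v + ((1/2) *\<^sub>R v + y) = v + y" for v y :: 'a
    by (simp_all flip: scaleR_add_left add.assoc)
  note step = second_order_reach_step[OF \<Omega> F xF]
  have X': "Ck_on 1 \<Omega> (\<lambda>x. - X x)" and Y': "Ck_on 1 \<Omega> (\<lambda>x. - Y x)"
    using X Y Ck_on_minus \<Omega> by blast+
  have "second_order_reach F x (0 + X x) (0 + A 0 + (1/2) *\<^sub>R A (X x))"
    unfolding A_def by (rule step[OF X second_order_reach_zero[OF xF]])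
  from step[OF Y this, folded B_def]
  have "second_order_reach F x (X x + Y x) ((1/2) *\<^sub>R A (X x) + B (X x) + (1/2) *\<^sub>R B (Y x))"
    by (simp add: A_lin)
  from step[OF X' tangent_field_minus[OF X(2)] this, unfolded A']
  have "second_order_reach F x (Y x) (B (X x) + (1/2) *\<^sub>R B (Y x) - A (Y x))"
    by (simp add: A_lin algebra_simps half)
  from step[OF Y' tangent_field_minus[OF Y(2)] this, unfolded B']
  have "second_order_reach F x 0 (B (X x) - A (Y x))"
    by (simp add: B_lin algebra_simps half)
  from second_order_reach_normal[OF this \<nu>] show ?thesis by (simp add: A_def B_def)
qed

text \<open>The bracket is antisymmetric, so exchanging the two fields supplies the opposite
  inequality.\<close>

lemma tangent_field_lie_bracket:
  fixes X Y :: "real^'n \<Rightarrow> real^'n"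
  assumes "open \<Omega>" "closedin (top_of_set \<Omega>) F"
    and "Ck_on 1 \<Omega> X" "tangent_field F X" and "Ck_on 1 \<Omega> Y" "tangent_field F Y"
  shows "tangent_field F (lie_bracket X Y)"
  unfolding tangent_field_def
proof (intro allI impI)
  fix x \<nu> assume \<nu>: "proximal_normal F x \<nu>"
  show "lie_bracket X Y x \<bullet> \<nu> = 0"
    using proximal_normal_bracket_le[OF assms \<nu>]
      proximal_normal_bracket_le[OF assms(1,2,5,6,3,4) \<nu>]
    by (simp add: lie_bracket_def inner_diff_left)
qed

lemma smooth_on_Ck_on: "smooth_on S f \<Longrightarrow> Ck_on k S f"
  by (simp add: smooth_on_def)

lemma smooth_on_lie_bracket:
  assumes "open \<Omega>" "smooth_on \<Omega> X" "smooth_on \<Omega> Y"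
  shows "smooth_on \<Omega> (lie_bracket X Y)"
  unfolding smooth_on_def lie_bracket_def
  by (intro allI Ck_on_diff Ck_on_directional_derivative smooth_on_Ck_on assms)

text \<open>Smoothness is carried through the induction because tangency of a bracket rests on both
  fields being \<open>C^1\<close>. Changing a field off \<Omega> is harmless, since proximal normals
  sit at points of \<open>F\<close>, which lies in \<Omega>.\<close>

lemma lie_module_smooth_tangent:
  assumes \<Omega>: "open \<Omega>" and F: "closedin (top_of_set \<Omega>) F"
    and S: "\<And>V. V \<in> S \<Longrightarrow> smooth_on \<Omega> V \<and> tangent_field F V"
    and Z: "Z \<in> lie_module \<Omega> S"
  shows "smooth_on \<Omega> Z \<and> tangent_field F Z"
  using Z
proof induction
  case (base X)
  then show ?case by (rule S)
next
  case zero
  then show ?case by (simp add: smooth_on_def Ck_on_const \<Omega> tangent_field_def)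
next
  case (add V W)
  then show ?case by (auto simp: smooth_on_def Ck_on_add \<Omega> tangent_field_def inner_add_left)
next
  case (scale c V)
  then show ?case by (auto simp: smooth_on_def Ck_on_scaleR \<Omega> tangent_field_def)
next
  case (bracket V W)
  then show ?case
    using tangent_field_lie_bracket[OF \<Omega> F] smooth_on_lie_bracket[OF \<Omega>] smooth_on_Ck_on by blast
next
  case (cong V W)
  have "W x \<bullet> \<nu> = 0" if "proximal_normal F x \<nu>" for x \<nu>
  proof -
    have "x \<in> \<Omega>" using that F closedin_imp_subset unfolding proximal_normal_def by blast
    then show ?thesis using that cong by (simp add: tangent_field_def)
  qed
  then show ?case
    using cong Ck_on_cong[OF \<Omega>, of V W] by (auto simp: smooth_on_def tangent_field_def)
qed

text \<open>The distance estimate with error 0 puts the curve at distance 0 from a point of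
  \<open>F\<close>. Times before \<open>t\<close> are reached by running the field backwards, which
  is again tangent.\<close>

lemma integral_curve_locally_invariant:
  fixes Z :: "'a::euclidean_space \<Rightarrow> 'a"
  assumes \<Omega>: "open \<Omega>" and F: "closedin (top_of_set \<Omega>) F"
    and Z: "Ck_on 1 \<Omega> Z" "tangent_field F Z"
    and I: "is_interval I" and t: "t \<in> I" "\<gamma> t \<in> F"
    and \<gamma>: "\<And>t. t \<in> I \<Longrightarrow> (\<gamma> has_vector_derivative Z (\<gamma> t)) (at t within I)"
  obtains d where "d > 0" "\<And>s. s \<in> I \<Longrightarrow> \<bar>s - t\<bar> < d \<Longrightarrow> \<gamma> s \<in> F"
proof -
  have x: "\<gamma> t \<in> \<Omega>" using t F closedin_imp_subset by blast
  obtain L r where L: "L \<ge> 0" "r > 0" "ball (\<gamma> t) r \<subseteq> \<Omega>"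
    "\<And>p q. p \<in> ball (\<gamma> t) r \<Longrightarrow> q \<in> ball (\<gamma> t) r \<Longrightarrow> norm (Z p - Z q) \<le> L * norm (p - q)"
    using C1_locally_Lipschitz[OF \<Omega> x Z(1)] by metis
  define \<rho> where "\<rho> = r / 4"
  have \<rho>: "\<rho> > 0" "3 * \<rho> < r" using L by (auto simp: \<rho>_def)
  have "continuous_on I \<gamma>"
    using has_vector_derivative_continuous[OF \<gamma>] by (simp add: continuous_on_eq_continuous_within)
  then obtain d1 where d1: "d1 > 0" "\<And>s. s \<in> I \<Longrightarrow> \<bar>s - t\<bar> < d1 \<Longrightarrow> dist (\<gamma> s) (\<gamma> t) < \<rho>"
    using t(1) \<rho>(1) unfolding continuous_on_iff dist_real_def by meson
  \<comment> \<open>The second entry ensures \<open>2 * L * T \<le> 1\<close> for every time span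
    \<open>T < d\<close>.\<close>
  define d where "d = min d1 (1 / (2 * L + 1))"
  show ?thesis
  proof (rule that)
    show "d > 0" using d1 L by (simp add: d_def)
    fix s assume s: "s \<in> I" "\<bar>s - t\<bar> < d"
    \<comment> \<open>The direction of time; for \<open>s = t\<close> it is 0, and so is
      \<open>T\<close>.\<close>
    define \<sigma> :: real where "\<sigma> = sgn (s - t)"
    define T where "T = \<bar>s - t\<bar>"
    have s_eq: "t + \<sigma> * T = s" by (simp add: \<sigma>_def T_def mult.commute[of "sgn _"] abs_mult_sgn)
    have \<sigma>: "\<bar>\<sigma>\<bar> \<le> 1" by (simp add: \<sigma>_def sgn_if)
    have inI: "t + \<sigma> * \<tau> \<in> I" if \<tau>: "\<tau> \<in> {0..T}" for \<tau>
    proof -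
      have "min s t \<le> t + \<sigma> * \<tau>" "t + \<sigma> * \<tau> \<le> max s t"
        using \<tau> by (auto simp: \<sigma>_def T_def sgn_if)
      moreover have "min s t \<in> I" "max s t \<in> I" using s t by (auto simp: min_def max_def)
      ultimately show ?thesis using I by (meson is_interval_1)
    qed
    have "2 * L * T \<le> 2 * L * (1 / (2 * L + 1))"
      using s L by (intro mult_left_mono) (auto simp: T_def d_def)
    also have "\<dots> \<le> 1" using L by simp
    finally have LT: "2 * L * T \<le> 1" .
    have "\<exists>q\<in>F. dist (\<gamma> (t + \<sigma> * T)) q \<le> 2 * 0 * T"
    proof (rule approx_integral_curve_near[where \<rho>=\<rho> and L=L and X="\<lambda>x. \<sigma> *\<^sub>R Z x"
          and \<gamma>="\<lambda>\<tau>. \<gamma> (t + \<sigma> * \<tau>)" and \<gamma>'="\<lambda>\<tau>. \<sigma> *\<^sub>R Z (\<gamma> (t + \<sigma> * \<tau>))"])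
      show "closed (F \<inter> cball (\<gamma> t) (3 * \<rho>))"
      proof (rule closed_Int_cball[OF F])
        have "cball (\<gamma> t) (3 * \<rho>) \<subseteq> ball (\<gamma> t) r" using \<rho> by auto
        then show "cball (\<gamma> t) (3 * \<rho>) \<subseteq> \<Omega>" using L(3) by blast
      qed
      show "tangent_field F (\<lambda>x. \<sigma> *\<^sub>R Z x)" using Z(2) by (simp add: tangent_field_def)
      show "norm (\<sigma> *\<^sub>R Z p - \<sigma> *\<^sub>R Z q) \<le> L * norm (p - q)"
        if "p \<in> cball (\<gamma> t) (2 * \<rho>)" "q \<in> cball (\<gamma> t) (2 * \<rho>)" for p q
      proof -
        have "norm (\<sigma> *\<^sub>R Z p - \<sigma> *\<^sub>R Z q) = \<bar>\<sigma>\<bar> * norm (Z p - Z q)"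
          by (simp flip: scaleR_diff_right)
        also have "\<dots> \<le> 1 * norm (Z p - Z q)" using \<sigma> by (intro mult_right_mono) auto
        also have "\<dots> \<le> L * norm (p - q)" using that \<rho> by (auto intro!: L(4))
        finally show ?thesis .
      qed
      fix \<tau> assume \<tau>: "\<tau> \<in> {0..T}"
      have "\<bar>\<sigma> * \<tau>\<bar> \<le> T" using \<tau> \<sigma> mult_mono[of "\<bar>\<sigma>\<bar>" 1 "\<bar>\<tau>\<bar>" T] by (simp add: abs_mult)
      then show "\<gamma> (t + \<sigma> * \<tau>) \<in> cball (\<gamma> t) \<rho>"
        using d1(2)[OF inI[OF \<tau>]] s by (simp add: T_def d_def dist_commute)
      have "((\<lambda>\<tau>. t + \<sigma> * \<tau>) has_derivative (\<lambda>h. \<sigma> * h)) (at \<tau> within {0..T})"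
        by (auto intro!: derivative_eq_intros)
      moreover have "(\<gamma> has_derivative (\<lambda>h. h *\<^sub>R Z (\<gamma> (t + \<sigma> * \<tau>)))) (at (t + \<sigma> * \<tau>) within (\<lambda>\<tau>. t + \<sigma> * \<tau>) ` {0..T})"
        using \<gamma>[OF inI[OF \<tau>]] unfolding has_vector_derivative_def
        by (rule has_derivative_subset) (use inI in auto)
      ultimately have "((\<gamma> \<circ> (\<lambda>\<tau>. t + \<sigma> * \<tau>)) has_derivative (\<lambda>h. h *\<^sub>R Z (\<gamma> (t + \<sigma> * \<tau>))) \<circ> (\<lambda>h. \<sigma> * h)) (at \<tau> within {0..T})"
        by (rule diff_chain_within)
      then show "((\<lambda>\<tau>. \<gamma> (t + \<sigma> * \<tau>)) has_vector_derivative \<sigma> *\<^sub>R Z (\<gamma> (t + \<sigma> * \<tau>))) (at \<tau> within {0..T})"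
        by (simp add: has_vector_derivative_def o_def mult.commute)
    qed (use t \<rho> L LT in \<open>auto simp: T_def\<close>)
    then show "\<gamma> s \<in> F" by (auto simp: s_eq)
  qed
qed

text \<open>The times at which the curve is in \<open>F\<close> form a set that is closed in
  \<open>I\<close> by continuity and open in \<open>I\<close> by local invariance; \<open>I\<close>
  is connected.\<close>

lemma integral_curve_invariant:
  fixes Z :: "real^'n \<Rightarrow> real^'n"
  assumes \<Omega>: "open \<Omega>" and F: "closedin (top_of_set \<Omega>) F"
    and Z: "Ck_on 1 \<Omega> Z" "tangent_field F Z"
    and \<Gamma>: "integral_curve \<Omega> Z \<Gamma>" and meets: "\<Gamma> \<inter> F \<noteq> {}"
  shows "\<Gamma> \<subseteq> F"
proof -
  obtain I \<gamma> where I: "is_interval I" "\<gamma> ` I \<subseteq> \<Omega>" "\<Gamma> = \<gamma> ` I"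
    and \<gamma>: "\<And>t. t \<in> I \<Longrightarrow> (\<gamma> has_vector_derivative Z (\<gamma> t)) (at t within I)"
    using \<Gamma> by (auto simp: integral_curve_def)
  define J where "J = I \<inter> \<gamma> -` F"
  have "continuous_on I \<gamma>"
    using has_vector_derivative_continuous[OF \<gamma>] by (simp add: continuous_on_eq_continuous_within)
  then have "closedin (top_of_set I) J"
    unfolding J_def using I(2) F by (intro continuous_closedin_preimage_gen[where T=\<Omega>]) auto
  moreover have "openin (top_of_set I) J"
  proof -
    have "\<exists>e>0. \<forall>s\<in>I. dist s t < e \<longrightarrow> s \<in> J" if "t \<in> J" for t
    proof -
      have "t \<in> I" "\<gamma> t \<in> F" using that by (auto simp: J_def)
      from integral_curve_locally_invariant[OF \<Omega> F Z I(1) this \<gamma>]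
      show ?thesis by (metis J_def IntI dist_real_def vimageI)
    qed
    then show ?thesis by (auto simp: openin_euclidean_subtopology_iff J_def)
  qed
  moreover have "connected I" using I(1) is_interval_connected by blast
  moreover have "J \<noteq> {}" using meets I(3) by (auto simp: J_def)
  ultimately have "J = I" using connected_clopen by blast
  then show ?thesis using I(3) by (auto simp: J_def)
qed

section \<open>The Hopf barrier\<close>

text \<open>At an interior maximum the gradient vanishes, so \<open>X (X f)\<close> reduces to the
  second derivative of \<open>f\<close> along the fixed vector \<open>X z\<close>. Were it positive,
  \<open>f\<close> would increase along the line through \<open>z\<close> in that direction.\<close>

lemma second_derivative_test_max:
  fixes f :: "'a::euclidean_space \<Rightarrow> real" and X :: "'a \<Rightarrow> 'a"
  assumes S: "open S" "z \<in> S" and f: "Ck_on 2 S f" and X: "Ck_on 1 S X"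
    and max: "\<And>x. x \<in> S \<Longrightarrow> f x \<le> f z"
  shows "frechet_derivative (\<lambda>x. frechet_derivative f (at x) (X x)) (at z) (X z) \<le> 0"
proof (rule ccontr)
  let ?D = "\<lambda>x. frechet_derivative f (at x)"
  define V where "V = X z"
  have f2: "Ck_on (Suc 1) S f" using f by (simp add: numeral_2_eq_2)
  have Df: "(f has_derivative ?D x) (at x)" if "x \<in> S" for x
    using Ck_on_has_derivative[OF f2 that] .
  have Df_sum: "?D x v = (\<Sum>b\<in>Basis. (v \<bullet> b) * ?D x b)" if "x \<in> S" for x v
    using frechet_derivative_eq_sum_Basis[of f x v] Df[OF that] by (auto simp: differentiable_def)
  define H where "H b = frechet_derivative (\<lambda>x. ?D x b) (at z)" for b
  have H: "((\<lambda>x. ?D x b) has_derivative H b) (at z)" for b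
    unfolding H_def using Ck_on_has_derivative[of 0 S "\<lambda>x. ?D x b" z] f2 S by simp
  have Xd: "(X has_derivative frechet_derivative X (at z)) (at z)"
    using Ck_on_has_derivative[of 0 S X z] X S by simp
  have grad0: "?D z v = 0" for v
    using differential_zero_maxmin[OF S(2,1) Df[OF S(2)]] max by auto
  define h where "h = (\<Sum>b\<in>Basis. (V \<bullet> b) * H b V)"
  \<comment> \<open>Product rule in coordinates; the terms with the derivative of \<open>X\<close>
    carry the factor \<open>?D z b\<close>, which is 0.\<close>
  have "((\<lambda>x. \<Sum>b\<in>Basis. (X x \<bullet> b) * ?D x b) has_derivative
      (\<lambda>k. \<Sum>b\<in>Basis. (V \<bullet> b) * H b k + (frechet_derivative X (at z) k \<bullet> b) * ?D z b)) (at z)"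
    unfolding V_def by (intro has_derivative_sum has_derivative_mult has_derivative_inner_left Xd H)
  then have "((\<lambda>x. ?D x (X x)) has_derivative
      (\<lambda>k. \<Sum>b\<in>Basis. (V \<bullet> b) * H b k + (frechet_derivative X (at z) k \<bullet> b) * ?D z b)) (at z)"
    by (rule has_derivative_transform_within_open[OF _ S]) (rule Df_sum[symmetric])
  from fun_cong[OF frechet_derivative_at[OF this], of V]
  have "frechet_derivative (\<lambda>x. ?D x (X x)) (at z) (X z) = h"
    by (simp add: h_def grad0 flip: V_def)
  moreover assume "\<not> frechet_derivative (\<lambda>x. ?D x (X x)) (at z) (X z) \<le> 0"
  ultimately have "h > 0" by simp
  have line: "((\<lambda>t. z + t *\<^sub>R V) has_derivative (\<lambda>k. k *\<^sub>R V)) (at t)" for t :: real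
    by (auto intro!: derivative_eq_intros)
  obtain r where r: "r > 0" "ball z r \<subseteq> S" using S openE by blast
  define g where "g t = (\<Sum>b\<in>Basis. (V \<bullet> b) * ?D (z + t *\<^sub>R V) b)" for t
  have "(g has_derivative (\<lambda>k. \<Sum>b\<in>Basis. (V \<bullet> b) * H b (k *\<^sub>R V))) (at 0)"
    unfolding g_def
    by (intro has_derivative_sum has_derivative_mult_right has_derivative_compose[OF line, of _ _ 0, simplified] H)
  moreover have "(\<Sum>b\<in>Basis. (V \<bullet> b) * H b (k *\<^sub>R V)) = h * k" for k
    by (simp add: h_def linear_scale[OF has_derivative_linear[OF H]] sum_distrib_left sum_distrib_right algebra_simps)
  ultimately have "(g has_real_derivative h) (at 0)"
    by (simp add: has_field_derivative_def)
  from has_real_derivative_pos_inc_right[OF this \<open>h > 0\<close>]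
  obtain d where d: "d > 0" "\<And>t. 0 < t \<Longrightarrow> t < d \<Longrightarrow> g 0 < g t" by auto
  have "g 0 = 0" by (simp add: g_def grad0)
  \<comment> \<open>The second entry keeps the segment inside \<open>ball z r\<close>; the summand 1
    covers the case \<open>V = 0\<close>.\<close>
  define T where "T = min (d / 2) (r / (2 * (norm V + 1)))"
  have "T \<le> d / 2" unfolding T_def by (rule min.cobounded1)
  moreover have "T > 0" using d(1) r(1) by (simp add: T_def add_nonneg_pos)
  ultimately have T: "T > 0" "T < d" using d(1) by auto
  have inS: "z + t *\<^sub>R V \<in> S" if "0 \<le> t" "t \<le> T" for t
  proof -
    have "t * norm V \<le> T * (norm V + 1)" using that by (intro mult_mono) auto
    also have "\<dots> \<le> r / (2 * (norm V + 1)) * (norm V + 1)"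
      by (intro mult_right_mono) (auto simp: T_def)
    also have "\<dots> = r / 2"
      using norm_ge_zero[of V] by (simp add: field_simps add_nonneg_eq_0_iff)
    finally have "t * norm V < r" using r(1) by simp
    then have "z + t *\<^sub>R V \<in> ball z r" using that by (simp add: dist_norm)
    then show ?thesis using r(2) by blast
  qed
  have der: "((\<lambda>t. f (z + t *\<^sub>R V)) has_real_derivative g t) (at t)" if "0 \<le> t" "t \<le> T" for t
  proof -
    have "((\<lambda>t. f (z + t *\<^sub>R V)) has_derivative (\<lambda>k. ?D (z + t *\<^sub>R V) (k *\<^sub>R V))) (at t)"
      by (rule has_derivative_compose[OF line Df[OF inS[OF that]]])
    moreover have "?D (z + t *\<^sub>R V) (k *\<^sub>R V) = g t * k" for k
      using Df_sum[OF inS[OF that], of "k *\<^sub>R V"] by (simp add: g_def sum_distrib_left algebra_simps)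
    ultimately show ?thesis by (simp add: has_field_derivative_def)
  qed
  obtain t where t: "0 < t" "t < T" "f (z + T *\<^sub>R V) - f (z + 0 *\<^sub>R V) = (T - 0) * g t"
    using MVT2[OF T(1), of "\<lambda>t. f (z + t *\<^sub>R V)" g] der by auto
  have "g t > 0" using d(2)[of t] t T \<open>g 0 = 0\<close> by simp
  then have "T * g t > 0" using T(1) by simp
  then have "f (z + T *\<^sub>R V) > f z" using t(3) by simp
  then show False using max[OF inS[of T]] T by simp
qed

section \<open>Gradients, and derivatives of the barrier function\<close>

lemma frechet_derivative_eq_grad:
  fixes f :: "real^'n \<Rightarrow> real"
  assumes "f differentiable at x"
  shows "frechet_derivative f (at x) v = grad f x \<bullet> v"
proof -
  have lin: "linear (frechet_derivative f (at x))"
    using assms by (rule linear_frechet_derivative)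
  have "frechet_derivative f (at x) v = frechet_derivative f (at x) (\<Sum>i\<in>UNIV. v $ i *\<^sub>R axis i 1)"
    using basis_expansion[of v] by (simp add: scalar_mult_eq_scaleR)
  then show ?thesis
    by (simp add: linear_sum[OF lin] linear_scale[OF lin] inner_vec_def grad_def pderiv_at_def mult.commute)
qed

lemma grad_eqI:
  fixes f :: "real^'n \<Rightarrow> real"
  assumes "(f has_derivative (\<lambda>v. G \<bullet> v)) (at x)"
  shows "grad f x = G"
  using frechet_derivative_at[OF assms, symmetric]
  by (simp add: vec_eq_iff grad_def pderiv_at_def inner_axis)

text \<open>Hopf's comparison function. For \<alpha> > 0 and R > 0 it is positive inside the ball
  about \<open>y\<close> with radius \<open>R\<close>, zero on the sphere and negative
  outside.\<close>

definition barrier_fun :: "real \<Rightarrow> 'a::euclidean_space \<Rightarrow> real \<Rightarrow> 'a \<Rightarrow> real" where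
  "barrier_fun \<alpha> y R x = exp (- (\<alpha> * ((x - y) \<bullet> (x - y)))) - exp (- (\<alpha> * R\<^sup>2))"

lemma barrier_fun_has_derivative:
  "(barrier_fun \<alpha> y R has_derivative
     (\<lambda>h. (- (2 * \<alpha> * exp (- (\<alpha> * ((x - y) \<bullet> (x - y))))) *\<^sub>R (x - y)) \<bullet> h)) (at x)"
  unfolding barrier_fun_def
  by (auto intro!: derivative_eq_intros simp: inner_commute algebra_simps)

lemma Ck_on_inner_affine:
  fixes y b :: "'a::real_inner"
  shows "open S \<Longrightarrow> Ck_on k S (\<lambda>x. (x - y) \<bullet> b)"
proof (cases k)
  case 0
  then show ?thesis by (auto intro!: continuous_intros)
next
  case (Suc k')
  assume "open S"
  then show ?thesis unfolding Suc
    by (intro Ck_on_SucI[where f'="\<lambda>x h. h \<bullet> b"])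
      (auto intro!: derivative_eq_intros Ck_on_const)
qed

lemma Ck_on_barrier_fun:
  assumes "open S"
  shows "Ck_on k S (barrier_fun \<alpha> (y::'a::euclidean_space) R)"
proof -
  have sum: "(x - y) \<bullet> (x - y) = (\<Sum>b\<in>Basis. ((x - y) \<bullet> b) *\<^sub>R ((x - y) \<bullet> b))" for x
    by (subst euclidean_inner) simp
  have "Ck_on k S (\<lambda>x. (x - y) \<bullet> (x - y))"
    unfolding sum by (intro Ck_on_sum Ck_on_scaleR Ck_on_inner_affine assms) auto
  then have "Ck_on k S (\<lambda>x. (- \<alpha>) * ((x - y) \<bullet> (x - y)))"
    by (rule Ck_on_bounded_linear[OF assms bounded_linear_mult_right])
  then show ?thesis unfolding barrier_fun_def
    by (intro Ck_on_diff Ck_on_exp Ck_on_const assms) simp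
qed

text \<open>The part quadratic in \<alpha> carries the square of
  \<open>X x \<bullet> (x - y)\<close>; where this product is nonzero, it dominates the linear part
  once \<alpha> is large.\<close>

lemma barrier_fun_vf_apply_twice:
  fixes X :: "real^'n \<Rightarrow> real^'n"
  assumes "X differentiable at x"
  shows "vf_apply X (vf_apply X (barrier_fun \<alpha> y R)) x =
    exp (- (\<alpha> * ((x - y) \<bullet> (x - y)))) * (4 * \<alpha>\<^sup>2 * (X x \<bullet> (x - y))\<^sup>2 -
      2 * \<alpha> * (X x \<bullet> X x + frechet_derivative X (at x) (X x) \<bullet> (x - y)))"
proof -
  have v: "vf_apply X (barrier_fun \<alpha> y R) = (\<lambda>x. - (2 * \<alpha> * exp (- (\<alpha> * ((x - y) \<bullet> (x - y))))) * ((x - y) \<bullet> X x))"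
    unfolding vf_apply_def frechet_derivative_at[OF barrier_fun_has_derivative, symmetric] by simp
  have X: "(X has_derivative frechet_derivative X (at x)) (at x)"
    using assms by (simp add: frechet_derivative_works)
  have "((\<lambda>x. - (2 * \<alpha> * exp (- (\<alpha> * ((x - y) \<bullet> (x - y))))) * ((x - y) \<bullet> X x)) has_derivative
    (\<lambda>h. - (2 * \<alpha> * exp (- (\<alpha> * ((x - y) \<bullet> (x - y))))) * ((x - y) \<bullet> frechet_derivative X (at x) h + h \<bullet> X x)
       + 4 * \<alpha>\<^sup>2 * exp (- (\<alpha> * ((x - y) \<bullet> (x - y)))) * (h \<bullet> (x - y)) * ((x - y) \<bullet> X x))) (at x)"
    by (auto intro!: derivative_eq_intros X simp: fun_eq_iff inner_commute algebra_simps power2_eq_square)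
  from fun_cong[OF frechet_derivative_at[OF this], of "X x"]
  show ?thesis unfolding v unfolding vf_apply_def
    by (auto simp: inner_commute algebra_simps power2_eq_square)
qed

lemma vf_apply_twice_add_scale:
  fixes u v :: "real^'n \<Rightarrow> real"
  assumes \<Omega>: "open \<Omega>" "z \<in> \<Omega>" and u: "Ck_on 2 \<Omega> u" and v: "Ck_on 2 \<Omega> v" and X: "Ck_on 1 \<Omega> X"
  shows "vf_apply X (vf_apply X (\<lambda>x. u x + e * v x)) z =
    vf_apply X (vf_apply X u) z + e * vf_apply X (vf_apply X v) z"
proof -
  have Suc: "Ck_on (Suc 1) \<Omega> u" "Ck_on (Suc 1) \<Omega> v" using u v by (simp_all add: numeral_2_eq_2)
  \<comment> \<open>The identity is needed on a neighbourhood of \<open>z\<close>, because it is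
    differentiated once more.\<close>
  have 1: "vf_apply X u x + e * vf_apply X v x = vf_apply X (\<lambda>x. u x + e * v x) x" if "x \<in> \<Omega>" for x
    unfolding vf_apply_def
    using frechet_derivative_at[OF has_derivative_add[OF Ck_on_has_derivative[OF Suc(1) that]
          has_derivative_mult_right[OF Ck_on_has_derivative[OF Suc(2) that]]], of e]
    by (simp add: fun_eq_iff)
  have d: "(vf_apply X w has_derivative frechet_derivative (vf_apply X w) (at z)) (at z)"
    if "Ck_on (Suc 1) \<Omega> w" for w
    using Ck_on_has_derivative[of 0 \<Omega> "vf_apply X w" z] Ck_on_directional_derivative[OF \<Omega>(1) that X] \<Omega>(2)
    by (simp add: vf_apply_def[abs_def])
  have "((\<lambda>x. vf_apply X u x + e * vf_apply X v x) has_derivative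
      (\<lambda>h. frechet_derivative (vf_apply X u) (at z) h + e * frechet_derivative (vf_apply X v) (at z) h)) (at z)"
    by (intro has_derivative_add has_derivative_mult_right d Suc)
  from has_derivative_transform_within_open[OF this \<Omega> 1]
  have "(vf_apply X (\<lambda>x. u x + e * v x) has_derivative
      (\<lambda>h. frechet_derivative (vf_apply X u) (at z) h + e * frechet_derivative (vf_apply X v) (at z) h)) (at z)"
    by simp
  from fun_cong[OF frechet_derivative_at[OF this], of "X z"]
  show ?thesis by (simp add: vf_apply_def[of X "vf_apply X _"])
qed

lemma continuous_on_open_eventually_less:
  fixes f :: "'a::metric_space \<Rightarrow> real"
  assumes "continuous_on S f" "open S" "x \<in> S" "f x < c"
  shows "\<forall>\<^sub>F y in nhds x. f y < c"
proof -
  have "(f \<longlongrightarrow> f x) (nhds x)"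
    using assms by (simp add: continuous_on_eq_continuous_at isCont_def tendsto_at_iff_tendsto_nhds)
  then show ?thesis using assms(4) by (rule order_tendstoD)
qed

text \<open>Hopf's argument. If \<open>X k\<close> were not orthogonal to a normal at
  \<open>x0\<close>, a small multiple of the barrier added to \<open>u\<close> would have an
  interior maximum \<open>z\<close> near \<open>x0\<close>. There the sum of squares of
  \<open>u + \<epsilon> v\<close> is at most 0, while that of \<open>v\<close> is large; since
  \<open>norm (grad u z)\<close> and \<open>M - u z\<close> are themselves controlled by
  \<open>\<epsilon>\<close>, the assumed inequality fails.\<close>

lemma sum_of_squares_max_tangent:
  fixes u :: "real^'n \<Rightarrow> real" and X :: "'i \<Rightarrow> real^'n \<Rightarrow> real^'n"
  assumes \<Omega>: "open \<Omega>" and u: "Ck_on 2 \<Omega> u" and I: "finite I" "k \<in> I"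
    and X: "\<And>k. k \<in> I \<Longrightarrow> Ck_on 1 \<Omega> (X k)"
    and max: "\<And>x. x \<in> \<Omega> \<Longrightarrow> u x \<le> M"
    and ineq: "\<And>x0. x0 \<in> \<Omega> \<Longrightarrow> u x0 = M \<Longrightarrow> \<exists>K\<ge>0. \<forall>\<^sub>F x in nhds x0.
      - K * (norm (grad u x) + (M - u x)) \<le> (\<Sum>k\<in>I. vf_apply (X k) (vf_apply (X k) u) x)"
  shows "tangent_field {x\<in>\<Omega>. u x = M} (X k)"
  unfolding tangent_field_def
proof (intro allI impI, rule ccontr)
  fix x0 \<nu> assume \<nu>: "proximal_normal {x\<in>\<Omega>. u x = M} x0 \<nu>" and ne: "X k x0 \<bullet> \<nu> \<noteq> 0"
  have x0: "x0 \<in> \<Omega>" "u x0 = M" using \<nu> by (auto simp: proximal_normal_def)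
  \<comment> \<open>Halving the normal leaves a closed ball that meets \<open>F\<close> in \<open>x0\<close> only.\<close>
  define y where "y = x0 + \<nu> /\<^sub>R 2"
  define R where "R = norm \<nu> / 2"
  have R: "R > 0" using ne by (auto simp: R_def)
  have yR: "(x0 - y) \<bullet> (x0 - y) = R\<^sup>2" "norm (x0 - y) = R"
    by (simp_all add: y_def R_def power2_norm_eq_inner[symmetric] power_divide power2_eq_square dot_square_norm)
  have outside: "norm (p - y) > R" if p: "p \<in> \<Omega>" "u p = M" "p \<noteq> x0" for p
  proof -
    define w where "w = p - x0"
    have "norm \<nu> \<le> norm (w - \<nu>)"
      using \<nu> p by (auto simp: proximal_normal_def dist_norm w_def algebra_simps)
    then have "(norm \<nu>)\<^sup>2 \<le> (norm (w - \<nu>))\<^sup>2" by (intro power_mono) auto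
    then have "2 * (w \<bullet> \<nu>) \<le> w \<bullet> w"
      by (simp add: power2_norm_eq_inner inner_diff_left inner_diff_right inner_commute)
    moreover have "w \<bullet> w > 0" using p by (simp add: w_def)
    moreover have "p - y = w - \<nu> /\<^sub>R 2" by (simp add: w_def y_def)
    then have "(norm (p - y))\<^sup>2 = w \<bullet> w - w \<bullet> \<nu> + R\<^sup>2"
      by (simp add: power2_norm_eq_inner R_def power_divide inner_diff_left inner_diff_right inner_commute)
    ultimately have "(norm (p - y))\<^sup>2 > R\<^sup>2" by linarith
    then show ?thesis using power2_less_imp_less by fastforce
  qed
  obtain K where K: "K \<ge> 0" and evK: "\<forall>\<^sub>F x in nhds x0.
      - K * (norm (grad u x) + (M - u x)) \<le> (\<Sum>k\<in>I. vf_apply (X k) (vf_apply (X k) u) x)"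
    using ineq[OF x0] by blast
  \<comment> \<open>\<open>q\<close> and \<open>S\<close> are the coefficients, up to the factors 4
    and -2, of \<open>\<alpha>\<^sup>2\<close> and \<open>\<alpha>\<close> in the sum of squares
    applied to the barrier.\<close>
  define q where "q x = (\<Sum>k\<in>I. (X k x \<bullet> (x - y))\<^sup>2)" for x
  define S where "S x = (\<Sum>k\<in>I. X k x \<bullet> X k x + frechet_derivative (X k) (at x) (X k x) \<bullet> (x - y))" for x
  define c where "c = q x0"
  have "X k x0 \<bullet> (x0 - y) \<noteq> 0" using ne by (simp add: y_def)
  then have "(X k x0 \<bullet> (x0 - y))\<^sup>2 > 0" by simp
  then have c: "c > 0" unfolding c_def q_def using I by (intro sum_pos2) auto
  define C where "C = \<bar>S x0\<bar> + 1"
  have contX: "continuous_on \<Omega> (X k)" if "k \<in> I" for k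
    using X[OF that] by (rule Ck_on_continuous)
  have contD: "continuous_on \<Omega> (\<lambda>x. frechet_derivative (X k) (at x) (X k x))" if "k \<in> I" for k
    using Ck_on_directional_derivative[OF \<Omega>, of 0 "X k" "X k"] X[OF that] contX[OF that] by simp
  have contq: "continuous_on \<Omega> (\<lambda>x. - q x)" and contS: "continuous_on \<Omega> S"
    unfolding q_def S_def by (intro continuous_intros contX contD; assumption)+
  have "\<forall>\<^sub>F x in nhds x0. - q x < - (c / 2)"
    using c by (intro continuous_on_open_eventually_less[OF contq \<Omega> x0(1)]) (simp add: c_def)
  moreover have "\<forall>\<^sub>F x in nhds x0. S x < C"
    by (intro continuous_on_open_eventually_less[OF contS \<Omega> x0(1)]) (simp add: C_def)
  moreover have "\<forall>\<^sub>F x in nhds x0. norm (x - y) < R + 1"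
    by (rule continuous_on_open_eventually_less[of UNIV]) (auto intro!: continuous_intros simp: yR)
  moreover have "\<forall>\<^sub>F x in nhds x0. x \<in> \<Omega>" using \<Omega> x0(1) by (rule eventually_nhds_in_open)
  ultimately have "\<forall>\<^sub>F x in nhds x0. x \<in> \<Omega> \<and> q x > c / 2 \<and> S x < C \<and> norm (x - y) < R + 1 \<and>
      - K * (norm (grad u x) + (M - u x)) \<le> (\<Sum>k\<in>I. vf_apply (X k) (vf_apply (X k) u) x)"
    using evK by eventually_elim auto
  then obtain e where e: "e > 0" "\<And>x. dist x x0 < e \<Longrightarrow> x \<in> \<Omega> \<and> q x > c / 2 \<and> S x < C \<and> norm (x - y) < R + 1 \<and>
      - K * (norm (grad u x) + (M - u x)) \<le> (\<Sum>k\<in>I. vf_apply (X k) (vf_apply (X k) u) x)"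
    unfolding eventually_nhds_metric by blast
  define \<rho> where "\<rho> = e / 2"
  have near: "dist x x0 < e" if "x \<in> cball x0 \<rho>" for x
    using e(1) that by (auto simp: \<rho>_def dist_commute)
  have sub: "cball x0 \<rho> \<subseteq> \<Omega>" using near e(2) by blast
  have rho: "\<rho> > 0" using e(1) by (simp add: \<rho>_def)
  \<comment> \<open>Large enough for \<open>\<alpha> * c\<close> to beat the bound \<open>C\<close>
    for \<open>S\<close> together with the contributions of \<open>K\<close>, which is what
    \<open>key\<close> requires.\<close>
  define \<alpha> where "\<alpha> = 1 + (C + K * (R + 1) + K) / c"
  have nn: "C + K * (R + 1) + K \<ge> 0" using K R by (simp add: C_def)
  then have \<alpha>: "\<alpha> \<ge> 1" using c by (simp add: \<alpha>_def)
  have \<alpha>c: "\<alpha> * c > C + K * (R + 1) + K" using c by (simp add: \<alpha>_def field_simps)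
  have key: "4 * \<alpha>\<^sup>2 * (c / 2) - 2 * \<alpha> * C > K * (2 * \<alpha> * (R + 1) + 1)"
  proof -
    have "2 * \<alpha> * (\<alpha> * c) > 2 * \<alpha> * (C + K * (R + 1) + K)"
      using \<alpha>c \<alpha> by (intro mult_strict_left_mono) auto
    moreover have "2 * \<alpha> * K \<ge> 1 * K" using \<alpha> K by (intro mult_right_mono) auto
    ultimately show ?thesis by (simp add: algebra_simps power2_eq_square)
  qed
  define v where "v = barrier_fun \<alpha> y R"
  define E where "E x = exp (- (\<alpha> * ((x - y) \<bullet> (x - y))))" for x
  have E0: "E x > 0" for x by (simp add: E_def)
  have vE: "v x = E x - exp (- (\<alpha> * R\<^sup>2))" for x by (simp add: v_def barrier_fun_def E_def)
  have "E x \<le> 1" for x using \<alpha> by (simp add: E_def)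
  then have v1: "v x < 1" for x unfolding vE using exp_gt_zero[of "- (\<alpha> * R\<^sup>2)"] by (smt (verit))
  have vx0: "v x0 = 0" by (simp add: vE E_def yR)
  have vneg: "v x < 0" if "norm (x - y) > R" for x
  proof -
    have "(norm (x - y))\<^sup>2 > R\<^sup>2" using that R by (intro power_strict_mono) auto
    then show ?thesis using \<alpha> by (simp add: vE E_def power2_norm_eq_inner)
  qed
  \<comment> \<open>On the part \<open>W\<close> of the small sphere inside the closed barrier ball,
    \<open>u\<close> stays below some \<open>m < M\<close> and \<open>v < 1\<close>, so
    \<open>\<epsilon> = M - m\<close> works. On the rest of the sphere \<open>v\<close> is negative
    and \<open>u \<le> M\<close> suffices.\<close>
  obtain \<epsilon> where \<epsilon>: "\<epsilon> > 0" "\<And>x. x \<in> sphere x0 \<rho> \<Longrightarrow> u x + \<epsilon> * v x < M"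
  proof -
    define W where "W = sphere x0 \<rho> \<inter> cball y R"
    have W: "compact W" unfolding W_def by (simp add: compact_Int_closed)
    have uW: "u x < M" if "x \<in> W" for x
    proof -
      have x: "x \<in> \<Omega>" "x \<noteq> x0" "norm (x - y) \<le> R"
        using that sub rho by (auto simp: W_def dist_norm norm_minus_commute)
      then show ?thesis using outside[of x] max[of x] by linarith
    qed
    have contu: "continuous_on W u"
      by (rule continuous_on_subset[OF Ck_on_continuous[OF u]]) (use sub in \<open>auto simp: W_def\<close>)
    obtain m where m: "m < M" "\<And>x. x \<in> W \<Longrightarrow> u x \<le> m"
    proof (cases "W = {}")
      case True
      then show ?thesis using that[of "M - 1"] by auto
    next
      case False
      then obtain x where "x \<in> W" "\<And>x'. x' \<in> W \<Longrightarrow> u x' \<le> u x"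
        using continuous_attains_sup[OF W _ contu] by blast
      then show ?thesis using that[of "u x"] uW by blast
    qed
    show ?thesis
    proof (rule that[of "M - m"])
      fix x assume x: "x \<in> sphere x0 \<rho>"
      show "u x + (M - m) * v x < M"
      proof (cases "x \<in> W")
        case True
        have "(M - m) * v x < (M - m) * 1" using m(1) v1[of x] by (intro mult_strict_left_mono) auto
        then show ?thesis using m(2)[OF True] by simp
      next
        case False
        then have "norm (x - y) > R" using x by (simp add: W_def dist_norm norm_minus_commute)
        then have "(M - m) * v x < 0" using vneg m(1) by (simp add: mult_pos_neg)
        moreover have "x \<in> \<Omega>" using x sub by (auto simp: sphere_def)
        then have "u x \<le> M" by (rule max)
        ultimately show ?thesis by simp
      qed
    qed (use m in auto)
  qed
  define f where "f x = u x + \<epsilon> * v x" for x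
  have Ckv: "Ck_on k \<Omega> v" for k unfolding v_def by (rule Ck_on_barrier_fun[OF \<Omega>])
  have Ckf: "Ck_on 2 \<Omega> f"
    unfolding f_def by (intro Ck_on_add Ck_on_bounded_linear[OF \<Omega> bounded_linear_mult_right] \<Omega> u Ckv)
  then have "continuous_on \<Omega> f"
    by (rule Ck_on_continuous)
  then have "continuous_on (cball x0 \<rho>) f" using sub continuous_on_subset by blast
  then obtain z where z: "z \<in> cball x0 \<rho>" "\<And>x. x \<in> cball x0 \<rho> \<Longrightarrow> f x \<le> f z"
    using continuous_attains_sup[of "cball x0 \<rho>" f] rho by (auto simp: less_imp_le)
  \<comment> \<open>The barrier vanishes at \<open>x0\<close>, so \<open>f x0 = M\<close>, which
    exceeds every value of \<open>f\<close> on the sphere: the maximum is interior.\<close>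
  have fz: "f z \<ge> M" using z(2)[of x0] rho by (simp add: f_def vx0 x0)
  then have "z \<notin> sphere x0 \<rho>" using \<epsilon>(2)[of z] by (auto simp: f_def)
  then have zb: "z \<in> ball x0 \<rho>" using z(1) by auto
  have zO: "z \<in> \<Omega>" using z(1) sub by blast
  have mono: "Ck_on n (ball x0 \<rho>) g" if "Ck_on n \<Omega> g" for n and g :: "real^'n \<Rightarrow> 'c::real_normed_vector"
  proof -
    have "ball x0 \<rho> \<subseteq> \<Omega>" using sub by (meson ball_subset_cball subset_trans)
    with that show ?thesis
      by (induction n arbitrary: g) (auto intro: continuous_on_subset)
  qed
  have XXf: "vf_apply (X k) (vf_apply (X k) f) z \<le> 0" if "k \<in> I" for k
    using second_derivative_test_max[OF open_ball zb mono[OF Ckf] mono[OF X[OF that]]] z(2)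
    by (auto simp: vf_apply_def[abs_def])
  have "0 \<ge> (\<Sum>k\<in>I. vf_apply (X k) (vf_apply (X k) f) z)" by (rule sum_nonpos) (rule XXf)
  also have "(\<Sum>k\<in>I. vf_apply (X k) (vf_apply (X k) f) z) =
     (\<Sum>k\<in>I. vf_apply (X k) (vf_apply (X k) u) z) + \<epsilon> * (\<Sum>k\<in>I. vf_apply (X k) (vf_apply (X k) v) z)"
    unfolding f_def using vf_apply_twice_add_scale[OF \<Omega> zO u Ckv X]
    by (simp add: sum.distrib sum_distrib_left)
  also have "(\<Sum>k\<in>I. vf_apply (X k) (vf_apply (X k) v) z) = E z * (4 * \<alpha>\<^sup>2 * q z - 2 * \<alpha> * S z)"
  proof -
    have "X k differentiable at z" if "k \<in> I" for k using X[OF that] zO by simp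
    then have "(\<Sum>k\<in>I. vf_apply (X k) (vf_apply (X k) v) z) =
      (\<Sum>k\<in>I. E z * (4 * \<alpha>\<^sup>2 * (X k z \<bullet> (z - y))\<^sup>2 -
        2 * \<alpha> * (X k z \<bullet> X k z + frechet_derivative (X k) (at z) (X k z) \<bullet> (z - y))))"
      unfolding v_def E_def by (intro sum.cong refl barrier_fun_vf_apply_twice) auto
    then show ?thesis by (simp only: q_def S_def sum_subtractf sum_distrib_left[symmetric])
  qed
  finally have A: "(\<Sum>k\<in>I. vf_apply (X k) (vf_apply (X k) u) z) \<le> - (\<epsilon> * (E z * (4 * \<alpha>\<^sup>2 * q z - 2 * \<alpha> * S z)))"
    by linarith
  note ez = e(2)[OF near[OF z(1)]]
  \<comment> \<open>The gradient of \<open>f\<close> vanishes at \<open>z\<close>, so that of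
    \<open>u\<close> is \<open>- \<epsilon>\<close> times the gradient of the barrier.\<close>
  have grad: "norm (grad u z) \<le> \<epsilon> * (E z * (2 * \<alpha> * (R + 1)))"
  proof -
    have du: "(u has_derivative frechet_derivative u (at z)) (at z)"
      using Ck_on_has_derivative[of 1 \<Omega> u z] u zO by (simp add: numeral_2_eq_2)
    have "(f has_derivative (\<lambda>h. frechet_derivative u (at z) h + \<epsilon> * ((- (2 * \<alpha> * E z) *\<^sub>R (z - y)) \<bullet> h))) (at z)"
      unfolding f_def v_def E_def
      by (intro has_derivative_add has_derivative_mult_right du barrier_fun_has_derivative)
    from differential_zero_maxmin[OF zb open_ball this] z(2)
    have "frechet_derivative u (at z) h + \<epsilon> * ((- (2 * \<alpha> * E z) *\<^sub>R (z - y)) \<bullet> h) = 0" for h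
      by (auto simp: fun_eq_iff)
    then have "frechet_derivative u (at z) h = ((\<epsilon> * (2 * \<alpha> * E z)) *\<^sub>R (z - y)) \<bullet> h" for h
      by (simp add: algebra_simps add_eq_0_iff)
    then have "frechet_derivative u (at z) = (\<lambda>h. ((\<epsilon> * (2 * \<alpha> * E z)) *\<^sub>R (z - y)) \<bullet> h)" by blast
    with du have "grad u z = (\<epsilon> * (2 * \<alpha> * E z)) *\<^sub>R (z - y)" by (intro grad_eqI) simp
    then have "norm (grad u z) = \<epsilon> * (2 * \<alpha> * E z) * norm (z - y)"
      using \<epsilon>(1) \<alpha> E0[of z] by (simp add: abs_mult)
    also have "\<dots> \<le> \<epsilon> * (2 * \<alpha> * E z) * (R + 1)"
      using \<epsilon>(1) \<alpha> E0[of z] ez by (intro mult_left_mono) auto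
    finally show ?thesis by (simp add: algebra_simps)
  qed
  have Mu: "M - u z \<le> \<epsilon> * E z"
  proof -
    have "\<epsilon> * v z \<le> \<epsilon> * E z" using \<epsilon>(1) by (simp add: vE)
    then show ?thesis using fz by (simp add: f_def)
  qed
  have "- (K * (\<epsilon> * (E z * (2 * \<alpha> * (R + 1))) + \<epsilon> * E z)) \<le> - (\<epsilon> * (E z * (4 * \<alpha>\<^sup>2 * q z - 2 * \<alpha> * S z)))"
  proof -
    have "K * (norm (grad u z) + (M - u z)) \<le> K * (\<epsilon> * (E z * (2 * \<alpha> * (R + 1))) + \<epsilon> * E z)"
      by (intro mult_left_mono add_mono grad Mu K)
    then show ?thesis using A ez by simp
  qed
  \<comment> \<open>All terms share the positive factor \<open>\<epsilon> * E z\<close>; cancelling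
    it leaves an inequality between constants that contradicts \<open>key\<close>.\<close>
  then have "\<epsilon> * E z * (4 * \<alpha>\<^sup>2 * q z - 2 * \<alpha> * S z) \<le> \<epsilon> * E z * (K * (2 * \<alpha> * (R + 1) + 1))"
    by (simp add: algebra_simps)
  then have "4 * \<alpha>\<^sup>2 * q z - 2 * \<alpha> * S z \<le> K * (2 * \<alpha> * (R + 1) + 1)"
    using \<epsilon>(1) E0[of z] by (simp add: mult_le_cancel_left_pos)
  moreover have "4 * \<alpha>\<^sup>2 * q z \<ge> 4 * \<alpha>\<^sup>2 * (c / 2)" using ez by (intro mult_left_mono) auto
  moreover have "2 * \<alpha> * S z \<le> 2 * \<alpha> * C" using ez \<alpha> by (intro mult_left_mono) auto
  ultimately show False using key by linarith
qed

section \<open>Linearization of the quasilinear operator\<close>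

lemma smooth_on_pderiv_at: "smooth_on S f \<Longrightarrow> smooth_on S (pderiv_at i f)"
  unfolding smooth_on_def pderiv_at_def[abs_def] by (blast intro: Ck_on_frechet)

lemma smooth_on_differentiable: "smooth_on S f \<Longrightarrow> x \<in> S \<Longrightarrow> f differentiable at x"
  using smooth_on_Ck_on[of S f 1] by simp

lemma smooth_on_continuous: "smooth_on S f \<Longrightarrow> continuous_on S f"
  using smooth_on_Ck_on[of S f 0] by simp

lemma continuous_on_grad: "smooth_on S f \<Longrightarrow> continuous_on S (grad f)"
  unfolding grad_def[abs_def]
  by (intro continuous_on_vec_lambda smooth_on_continuous smooth_on_pderiv_at)

lemma pderiv_at_diff:
  assumes "f differentiable at x" "g differentiable at x"
  shows "pderiv_at i (\<lambda>x. f x - g x) x = pderiv_at i f x - pderiv_at i g x"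
  using frechet_derivative_at[OF has_derivative_diff[OF assms[unfolded frechet_derivative_works]]]
  by (simp add: pderiv_at_def fun_eq_iff)

lemma pderiv_at_cong:
  assumes "open S" "x \<in> S" "\<And>y. y \<in> S \<Longrightarrow> f y = g y" "f differentiable at x"
  shows "pderiv_at i f x = pderiv_at i g x"
  using frechet_derivative_at[OF has_derivative_transform_within_open[OF
        assms(4)[unfolded frechet_derivative_works] assms(1,2,3)]]
  by (simp add: pderiv_at_def)

lemma grad_diff:
  assumes "f differentiable at x" "g differentiable at x"
  shows "grad (\<lambda>x. f x - g x) x = grad f x - grad g x"
  using pderiv_at_diff[OF assms] by (simp add: grad_def vec_eq_iff)

lemma second_order_op_diff:
  assumes "open S" "x \<in> S" "smooth_on S f" "smooth_on S g"
  shows "second_order_op A (\<lambda>x. f x - g x) x = second_order_op A f x - second_order_op A g x"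
proof -
  have "pderiv_at i (pderiv_at j (\<lambda>x. f x - g x)) x =
      pderiv_at i (pderiv_at j f) x - pderiv_at i (pderiv_at j g) x" for i j
  proof -
    note d = smooth_on_differentiable[OF smooth_on_pderiv_at]
    have "pderiv_at i (\<lambda>x. pderiv_at j f x - pderiv_at j g x) x = pderiv_at i (pderiv_at j (\<lambda>x. f x - g x)) x"
      using assms by (intro pderiv_at_cong[OF assms(1,2)] pderiv_at_diff[symmetric] differentiable_diff d)
        (auto intro: smooth_on_differentiable)
    then show ?thesis using pderiv_at_diff[OF d d] assms by metis
  qed
  then show ?thesis by (simp add: second_order_op_def sum_subtractf right_diff_distrib)
qed

lemma second_order_op_coefficient_bound:
  assumes "\<And>i j. \<bar>pderiv_at i (pderiv_at j f) x\<bar> \<le> H"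
  shows "\<bar>second_order_op A f x - second_order_op B f x\<bar> \<le>
    of_nat (CARD('n) * CARD('n)) * H * norm (A x - B (x::real^'n))"
proof -
  have "\<bar>second_order_op A f x - second_order_op B f x\<bar> =
      \<bar>\<Sum>i\<in>UNIV. \<Sum>j\<in>UNIV. (A x - B x) $ i $ j * pderiv_at i (pderiv_at j f) x\<bar>"
    by (simp add: second_order_op_def sum_subtractf left_diff_distrib)
  also have "\<dots> \<le> (\<Sum>i\<in>(UNIV::'n set). \<Sum>j\<in>(UNIV::'n set). norm (A x - B x) * H)"
  proof (intro order_trans[OF sum_abs] sum_mono)
    fix i j
    have "\<bar>(A x - B x) $ i $ j\<bar> \<le> norm (A x - B x)"
      using Finite_Cartesian_Product.norm_nth_le[of "(A x - B x) $ i" j] Finite_Cartesian_Product.norm_nth_le[of "A x - B x" i] by simp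
    then show "\<bar>(A x - B x) $ i $ j * pderiv_at i (pderiv_at j f) x\<bar> \<le> norm (A x - B x) * H"
      unfolding abs_mult using assms by (intro mult_mono) auto
  qed
  also have "\<dots> = of_nat (CARD('n) * CARD('n)) * H * norm (A x - B x)" by simp
  finally show ?thesis .
qed

text \<open>If \<open>M = 0\<close>, then \<open>f\<close> and \<open>g\<close> agree at
  \<open>x0\<close> and a joint Lipschitz bound applies, with
  \<open>\<bar>f x - g x\<bar> = M - (f x - g x)\<close>. If \<open>M > 0\<close>, the values of
  \<open>f\<close> may lie outside the Lipschitz ball, but \<open>f > g\<close> near
  \<open>x0\<close>, so monotonicity in \<open>z\<close> first replaces \<open>f\<close> by
  \<open>g\<close> and only the gradient variable changes.\<close>

lemma lower_order_difference_bound: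
  fixes b :: "real^'n \<Rightarrow> real \<Rightarrow> real^'n \<Rightarrow> real"
  assumes \<Omega>: "open \<Omega>" "x0 \<in> \<Omega>"
    and b: "Ck_on 1 (\<Omega> \<times> UNIV \<times> UNIV) (\<lambda>(x, z, p). b x z p)"
    and dec: "\<And>x z p. x \<in> \<Omega> \<Longrightarrow> deriv (\<lambda>s. b x s p) z \<le> 0"
    and cont: "continuous_on \<Omega> f" "continuous_on \<Omega> g" "continuous_on \<Omega> P" "continuous_on \<Omega> Q"
    and max: "\<And>x. x \<in> \<Omega> \<Longrightarrow> f x - g x \<le> M" "f x0 - g x0 = M" "M \<ge> 0" and PQ: "P x0 = Q x0"
  shows "\<exists>L\<ge>0. \<forall>\<^sub>F x in nhds x0. b x (f x) (P x) - b x (g x) (Q x) \<le> L * (norm (P x - Q x) + (M - (f x - g x)))"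
proof -
  let ?S = "\<Omega> \<times> (UNIV::real set) \<times> (UNIV::(real^'n) set)" and ?b = "\<lambda>(x, z, p). b x z p"
  have S: "open ?S" using \<Omega> by (intro open_Times) auto
  have mem: "(x0, g x0, Q x0) \<in> ?S" using \<Omega> by simp
  obtain L d where L: "L \<ge> 0" "d > 0"
    "\<And>p q. p \<in> ball (x0, g x0, Q x0) d \<Longrightarrow> q \<in> ball (x0, g x0, Q x0) d \<Longrightarrow> norm (?b p - ?b q) \<le> L * norm (p - q)"
    using C1_locally_Lipschitz[OF S mem b] by metis
  have near: "\<forall>\<^sub>F x in nhds x0. (x, h x, R x) \<in> ball (x0, g x0, Q x0) d"
    if "continuous_on \<Omega> h" "continuous_on \<Omega> R" "h x0 = g x0" "R x0 = Q x0" for h R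
  proof -
    have "continuous_on \<Omega> (\<lambda>x. dist (x0, g x0, Q x0) (x, h x, R x))"
      by (intro continuous_intros that)
    from continuous_on_open_eventually_less[OF this \<Omega>, of d] show ?thesis using that L by simp
  qed
  have inO: "\<forall>\<^sub>F x in nhds x0. x \<in> \<Omega>" using \<Omega> by (rule eventually_nhds_in_open)
  have g_near: "\<forall>\<^sub>F x in nhds x0. (x, g x, Q x) \<in> ball (x0, g x0, Q x0) d"
    by (rule near[OF cont(2,4)]) auto
  show ?thesis
  proof (cases "M = 0")
    case True
    have "\<forall>\<^sub>F x in nhds x0. (x, f x, P x) \<in> ball (x0, g x0, Q x0) d"
      using True max PQ by (intro near[OF cont(1,3)]) auto
    then have "\<forall>\<^sub>F x in nhds x0. b x (f x) (P x) - b x (g x) (Q x) \<le> L * (norm (P x - Q x) + (M - (f x - g x)))"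
      using g_near inO
    proof eventually_elim
      case (elim x)
      have "b x (f x) (P x) - b x (g x) (Q x) \<le> L * norm ((x, f x, P x) - (x, g x, Q x))"
        using L(3)[OF elim(1,2)] by simp
      also have "norm ((x, f x, P x) - (x, g x, Q x)) \<le> norm (f x - g x) + norm (P x - Q x)"
        using sqrt_sum_squares_le_sum_abs[of "norm (f x - g x)" "norm (P x - Q x)"] by (simp add: norm_Pair)
      also have "norm (f x - g x) = M - (f x - g x)" using max(1)[OF elim(3)] True by simp
      finally show ?case using L(1) by (simp add: add.commute mult_left_mono)
    qed
    then show ?thesis using L(1) by blast
  next
    case False
    have "\<forall>\<^sub>F x in nhds x0. (x, g x, P x) \<in> ball (x0, g x0, Q x0) d"
      using PQ by (intro near[OF cont(2,3)]) auto
    moreover have "\<forall>\<^sub>F x in nhds x0. g x - f x < 0"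
      using cont max False by (intro continuous_on_open_eventually_less[OF _ \<Omega>] continuous_intros) auto
    ultimately have "\<forall>\<^sub>F x in nhds x0. b x (f x) (P x) - b x (g x) (Q x) \<le> L * (norm (P x - Q x) + (M - (f x - g x)))"
      using g_near inO
    proof eventually_elim
      case (elim x)
      have "b x (f x) (P x) \<le> b x (g x) (P x)"
      proof (rule DERIV_nonpos_imp_nonincreasing[where f="\<lambda>s. b x s (P x)"])
        show "g x \<le> f x" using elim by simp
        fix s :: real
        have "(\<lambda>s. (x, s, P x)) differentiable at s" by (simp add: differentiable_Pair)
        moreover have "?b differentiable at (x, s, P x)" using b elim by simp
        ultimately have "(?b \<circ> (\<lambda>s. (x, s, P x))) differentiable at s" by (rule differentiable_chain_at)
        then have "(\<lambda>s. b x s (P x)) differentiable at s" by (simp add: o_def)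
        then show "\<exists>y. ((\<lambda>s. b x s (P x)) has_real_derivative y) (at s) \<and> y \<le> 0"
          using dec[of x "P x" s] elim DERIV_deriv_iff_real_differentiable by blast
      qed
      moreover have "b x (g x) (P x) - b x (g x) (Q x) \<le> L * norm (P x - Q x)"
        using L(3)[OF elim(1,3)] by (simp add: norm_Pair)
      moreover have "L * norm (P x - Q x) \<le> L * (norm (P x - Q x) + (M - (f x - g x)))"
        using L(1) max(1)[OF elim(4)] by (intro mult_left_mono) auto
      ultimately show ?case by linarith
    qed
    then show ?thesis using L(1) by blast
  qed
qed

text \<open>Subtracting \<open>Q\<psi>\<close> from \<open>Q\<phi>\<close> bounds
  \<open>a(x, D\<phi>) D^2 u\<close> below by
  \<open>(a(x, D\<psi>) - a(x, D\<phi>)) D^2 \<psi>\<close> minus the difference of the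
  \<open>b\<close> terms. Local Lipschitz bounds control both by
  \<open>norm (grad u) + (M - u)\<close>, and the term \<open>Y u\<close> is absorbed as well. In
  the application \<open>P\<close> is the sum of squares.\<close>

lemma quasilinear_difference_inequality:
  fixes a :: "real^'n \<Rightarrow> real^'n \<Rightarrow> real^'n^'n" and \<phi> \<psi> :: "real^'n \<Rightarrow> real"
  assumes \<Omega>: "open \<Omega>" "x0 \<in> \<Omega>"
    and a: "smooth_on (\<Omega> \<times> UNIV) (\<lambda>(x, p). a x p)"
    and b: "smooth_on (\<Omega> \<times> UNIV \<times> UNIV) (\<lambda>(x, z, p). b x z p)"
    and \<phi>: "smooth_on \<Omega> \<phi>" and \<psi>: "smooth_on \<Omega> \<psi>" and Y: "continuous_on \<Omega> Y"
    and Q: "\<And>x. x \<in> \<Omega> \<Longrightarrow> quasilinear_op a b \<psi> x \<le> quasilinear_op a b \<phi> x"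
    and dec: "\<And>x z p. x \<in> \<Omega> \<Longrightarrow> deriv (\<lambda>s. b x s p) z \<le> 0"
    and L: "\<And>x. x \<in> \<Omega> \<Longrightarrow>
      second_order_op (\<lambda>y. a y (grad \<phi> y)) (\<lambda>x. \<phi> x - \<psi> x) x = P x + vf_apply Y (\<lambda>x. \<phi> x - \<psi> x) x"
    and max: "\<And>x. x \<in> \<Omega> \<Longrightarrow> \<phi> x - \<psi> x \<le> M" "\<phi> x0 - \<psi> x0 = M" "M \<ge> 0"
  shows "\<exists>K\<ge>0. \<forall>\<^sub>F x in nhds x0.
    - K * (norm (grad (\<lambda>x. \<phi> x - \<psi> x) x) + (M - (\<phi> x - \<psi> x))) \<le> P x"
proof -
  let ?u = "\<lambda>x. \<phi> x - \<psi> x"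
  have grad_u: "grad ?u x = grad \<phi> x - grad \<psi> x" if "x \<in> \<Omega>" for x
    using that by (intro grad_diff smooth_on_differentiable[OF \<phi>] smooth_on_differentiable[OF \<psi>])
  have du: "(?u has_derivative (\<lambda>v. grad ?u x \<bullet> v)) (at x)" if "x \<in> \<Omega>" for x
  proof -
    have d: "?u differentiable at x"
      using that by (intro differentiable_diff smooth_on_differentiable[OF \<phi>] smooth_on_differentiable[OF \<psi>])
    moreover have "frechet_derivative ?u (at x) = (\<lambda>v. grad ?u x \<bullet> v)"
      using frechet_derivative_eq_grad[OF d] by blast
    ultimately show ?thesis by (simp add: frechet_derivative_works)
  qed
  have "(\<lambda>v. grad ?u x0 \<bullet> v) = (\<lambda>v. 0)"
    using differential_zero_maxmin[OF \<Omega>(2,1) du[OF \<Omega>(2)]] max by auto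
  then have "grad ?u x0 = 0" by (metis inner_eq_zero_iff)
  \<comment> \<open>Equal gradients at \<open>x0\<close> place both arguments of \<open>a\<close> in
    one Lipschitz ball for all nearby \<open>x\<close>.\<close>
  then have PQ: "grad \<phi> x0 = grad \<psi> x0" using grad_u[OF \<Omega>(2)] by simp
  note cont = smooth_on_continuous[OF \<phi>] smooth_on_continuous[OF \<psi>] continuous_on_grad[OF \<phi>] continuous_on_grad[OF \<psi>]
  obtain Lb where Lb: "Lb \<ge> 0" and evb: "\<forall>\<^sub>F x in nhds x0. b x (\<phi> x) (grad \<phi> x) - b x (\<psi> x) (grad \<psi> x)
      \<le> Lb * (norm (grad \<phi> x - grad \<psi> x) + (M - ?u x))"
    using lower_order_difference_bound[OF \<Omega> smooth_on_Ck_on[OF b] dec cont max PQ] by blast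
  let ?a = "\<lambda>(x, p). a x p"
  have S: "open (\<Omega> \<times> (UNIV::(real^'n) set))" "(x0, grad \<psi> x0) \<in> \<Omega> \<times> UNIV" using \<Omega> by (auto intro: open_Times)
  obtain La d where La: "La \<ge> 0" "d > 0"
    "\<And>p q. p \<in> ball (x0, grad \<psi> x0) d \<Longrightarrow> q \<in> ball (x0, grad \<psi> x0) d \<Longrightarrow> norm (?a p - ?a q) \<le> La * norm (p - q)"
    using C1_locally_Lipschitz[OF S smooth_on_Ck_on[OF a]] by metis
  have near: "\<forall>\<^sub>F x in nhds x0. (x, R x) \<in> ball (x0, grad \<psi> x0) d"
    if "continuous_on \<Omega> R" "R x0 = grad \<psi> x0" for R
  proof -
    have "continuous_on \<Omega> (\<lambda>x. dist (x0, grad \<psi> x0) (x, R x))" by (intro continuous_intros that)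
    from continuous_on_open_eventually_less[OF this \<Omega>, of d] show ?thesis using that La by simp
  qed
  \<comment> \<open>A common bound for the second derivatives of \<psi> near \<open>x0\<close>; the
    summand 1 leaves room for continuity.\<close>
  define H where "H = (\<Sum>i\<in>UNIV. \<Sum>j\<in>UNIV. \<bar>pderiv_at i (pderiv_at j \<psi>) x0\<bar>) + 1"
  have H0: "H \<ge> 0" unfolding H_def by (intro add_nonneg_nonneg sum_nonneg) auto
  have evH: "\<forall>\<^sub>F x in nhds x0. (\<Sum>i\<in>UNIV. \<Sum>j\<in>UNIV. \<bar>pderiv_at i (pderiv_at j \<psi>) x\<bar>) < H"
    unfolding H_def using \<Omega>
    by (intro continuous_on_open_eventually_less[of \<Omega>] continuous_intros smooth_on_continuous smooth_on_pderiv_at \<psi>) auto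
  define N where "N = norm (Y x0) + 1"
  have evY: "\<forall>\<^sub>F x in nhds x0. norm (Y x) < N"
    unfolding N_def using \<Omega> by (intro continuous_on_open_eventually_less[of \<Omega>] continuous_intros Y) auto
  define Ka where "Ka = of_nat (CARD('n) * CARD('n)) * H * La"
  have Ka: "Ka \<ge> 0" using H0 La by (simp add: Ka_def)
  have N: "N \<ge> 0" by (simp add: N_def)
  have inO: "\<forall>\<^sub>F x in nhds x0. x \<in> \<Omega>" using \<Omega> by (rule eventually_nhds_in_open)
  have "\<forall>\<^sub>F x in nhds x0. - (Ka + N + Lb) * (norm (grad ?u x) + (M - ?u x)) \<le> P x"
    using near[OF cont(3) PQ] near[OF cont(4) refl] evb evH evY inO
  proof eventually_elim
    case (elim x)
    have u: "grad ?u x = grad \<phi> x - grad \<psi> x" by (rule grad_u[OF elim(6)])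
    have M: "0 \<le> M - ?u x" using max(1)[OF elim(6)] by simp
    have "\<bar>pderiv_at i (pderiv_at j \<psi>) x\<bar> \<le> H" for i j
    proof -
      have "\<bar>pderiv_at i (pderiv_at j \<psi>) x\<bar> \<le> (\<Sum>j\<in>UNIV. \<bar>pderiv_at i (pderiv_at j \<psi>) x\<bar>)"
        by (intro member_le_sum) auto
      also have "\<dots> \<le> (\<Sum>i\<in>UNIV. \<Sum>j\<in>UNIV. \<bar>pderiv_at i (pderiv_at j \<psi>) x\<bar>)"
        by (rule member_le_sum[where f="\<lambda>i. \<Sum>j\<in>UNIV. \<bar>pderiv_at i (pderiv_at j \<psi>) x\<bar>"]) (auto intro: sum_nonneg)
      finally show ?thesis using elim(4) by linarith
    qed
    from second_order_op_coefficient_bound[OF this, of "\<lambda>y. a y (grad \<phi> y)" "\<lambda>y. a y (grad \<psi> y)"]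
    have "\<bar>second_order_op (\<lambda>y. a y (grad \<phi> y)) \<psi> x - second_order_op (\<lambda>y. a y (grad \<psi> y)) \<psi> x\<bar>
       \<le> of_nat (CARD('n) * CARD('n)) * H * norm (a x (grad \<phi> x) - a x (grad \<psi> x))" .
    also have "\<dots> \<le> of_nat (CARD('n) * CARD('n)) * H * (La * norm (grad ?u x))"
      using La(3)[OF elim(1,2)] H0 by (intro mult_left_mono) (auto simp: norm_Pair u)
    finally have A: "\<bar>second_order_op (\<lambda>y. a y (grad \<phi> y)) \<psi> x - second_order_op (\<lambda>y. a y (grad \<psi> y)) \<psi> x\<bar>
       \<le> Ka * norm (grad ?u x)" by (simp add: Ka_def)
    have "vf_apply Y ?u x = grad ?u x \<bullet> Y x"
      unfolding vf_apply_def using frechet_derivative_at[OF du[OF elim(6)]] by metis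
    also have "\<dots> \<le> norm (grad ?u x) * norm (Y x)" by (rule norm_cauchy_schwarz)
    also have "\<dots> \<le> norm (grad ?u x) * N" using elim(5) by (intro mult_left_mono) auto
    finally have B: "vf_apply Y ?u x \<le> N * norm (grad ?u x)" by (simp add: mult.commute)
    have C: "second_order_op (\<lambda>y. a y (grad \<phi> y)) \<phi> x - second_order_op (\<lambda>y. a y (grad \<phi> y)) \<psi> x = P x + vf_apply Y ?u x"
      using L[OF elim(6)] second_order_op_diff[OF \<Omega>(1) elim(6) \<phi> \<psi>] by simp
    have D: "second_order_op (\<lambda>y. a y (grad \<psi> y)) \<psi> x + b x (\<psi> x) (grad \<psi> x)
      \<le> second_order_op (\<lambda>y. a y (grad \<phi> y)) \<phi> x + b x (\<phi> x) (grad \<phi> x)"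
      using Q[OF elim(6)] by (simp add: quasilinear_op_def)
    \<comment> \<open>Padding, so that one constant multiplies both the gradient term and
      \<open>M - ?u x\<close>.\<close>
    have E: "0 \<le> (Ka + N) * (M - ?u x)" using M Ka N by simp
    have "P x \<ge> - (Ka * norm (grad ?u x)) - N * norm (grad ?u x) - Lb * (norm (grad ?u x) + (M - ?u x))"
      using A B C D elim(3)[folded u] by linarith
    then show ?case using E by (simp add: algebra_simps)
  qed
  moreover have "Ka + N + Lb \<ge> 0" using Ka N Lb by simp
  ultimately show ?thesis by blast
qed

section \<open>Propagation of the maximum along integral curves\<close>

theorem theoremA:
  fixes m r :: nat
    and \<Omega> :: "(real^'n) set"
    and a :: "real^'n \<Rightarrow> real^'n \<Rightarrow> real^'n^'n"
    and b :: "real^'n \<Rightarrow> real \<Rightarrow> real^'n \<Rightarrow> real"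
    and \<phi> \<psi> :: "real^'n \<Rightarrow> real"
    and X :: "nat \<Rightarrow> real^'n \<Rightarrow> real^'n"
    and Y Z :: "real^'n \<Rightarrow> real^'n"
    and \<Gamma> :: "(real^'n) set"
  assumes "m \<ge> 1" and "CARD('n) = m + 1"
    and "open \<Omega>" and "connected \<Omega>"
    and "smooth_on (\<Omega> \<times> UNIV) (\<lambda>(x, p). a x p)"
    and "smooth_on (\<Omega> \<times> UNIV \<times> UNIV) (\<lambda>(x, z, p). b x z p)"
    and "smooth_on \<Omega> \<phi>" and "smooth_on \<Omega> \<psi>"
    and "\<forall>x\<in>\<Omega>. quasilinear_op a b \<phi> x \<ge> quasilinear_op a b \<psi> x"
    and "\<forall>x\<in>\<Omega>. \<forall>p \<xi>. \<xi> \<bullet> (a x p *v \<xi>) \<ge> 0"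
    and "\<forall>x\<in>\<Omega>. \<forall>p i j. a x p $ i $ j = a x p $ j $ i"
    and "\<forall>x\<in>\<Omega>. \<forall>z p. deriv (\<lambda>s. b x s p) z \<le> 0"
    and "\<forall>k\<in>{1..r}. smooth_on \<Omega> (X k)" and "smooth_on \<Omega> Y"
    and "\<forall>f x. smooth_on \<Omega> f \<and> x \<in> \<Omega> \<longrightarrow>
           second_order_op (\<lambda>y. a y (grad \<phi> y)) f x =
             (\<Sum>k\<in>{1..r}. vf_apply (X k) (vf_apply (X k) f) x) + vf_apply Y f x"
    and "Z \<in> lie_module \<Omega> (X ` {1..r})"
    and "integral_curve \<Omega> Z \<Gamma>"
    and "\<exists>x0\<in>\<Gamma>. \<phi> x0 - \<psi> x0 \<ge> 0 \<and> (\<forall>x\<in>\<Omega>. \<phi> x - \<psi> x \<le> \<phi> x0 - \<psi> x0)"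
  shows "\<forall>y\<in>\<Gamma>. \<forall>x\<in>\<Omega>. \<phi> x - \<psi> x \<le> \<phi> y - \<psi> y"
proof -
  note \<Omega> = assms(3) and \<phi> = assms(7) and \<psi> = assms(8)
  let ?u = "\<lambda>x. \<phi> x - \<psi> x"
  obtain x0 where x0: "x0 \<in> \<Gamma>" "?u x0 \<ge> 0" "\<And>x. x \<in> \<Omega> \<Longrightarrow> ?u x \<le> ?u x0"
    using assms(18) by blast
  define M where "M = ?u x0"
  define F where "F = {x\<in>\<Omega>. ?u x = M}"
  have max: "?u x \<le> M" if "x \<in> \<Omega>" for x using x0(3)[OF that] by (simp add: M_def)
  have u: "smooth_on \<Omega> ?u" unfolding smooth_on_def
    by (intro allI Ck_on_diff \<Omega> smooth_on_Ck_on \<phi> \<psi>)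
  have F: "closedin (top_of_set \<Omega>) F"
    unfolding F_def by (rule continuous_closedin_preimage_constant[OF smooth_on_continuous[OF u]])
  \<comment> \<open>Tangency of the generators: the operator identity is applied to
    \<open>?u\<close> itself, which turns the comparison of \<open>Q\<phi>\<close> with
    \<open>Q\<psi>\<close> into the inequality for the sum of squares.\<close>
  have "smooth_on \<Omega> V \<and> tangent_field F V" if V: "V \<in> X ` {1..r}" for V
  proof -
    obtain k where k: "k \<in> {1..r}" "V = X k" using V by blast
    have "tangent_field F (X k)" unfolding F_def
    proof (rule sum_of_squares_max_tangent[OF \<Omega> smooth_on_Ck_on[OF u] finite_atLeastAtMost k(1) _ max])
      show "Ck_on 1 \<Omega> (X k)" if "k \<in> {1..r}" for k using assms(13) that smooth_on_Ck_on by blast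
      fix x1 assume x1: "x1 \<in> \<Omega>" "?u x1 = M"
      show "\<exists>K\<ge>0. \<forall>\<^sub>F x in nhds x1. - K * (norm (grad ?u x) + (M - ?u x))
          \<le> (\<Sum>k\<in>{1..r}. vf_apply (X k) (vf_apply (X k) ?u) x)"
        by (rule quasilinear_difference_inequality[OF \<Omega> x1(1) assms(5,6) \<phi> \<psi> smooth_on_continuous[OF assms(14)]])
          (use assms(9,12,15) u max x1 x0(2) in \<open>auto simp: M_def\<close>)
    qed
    then show ?thesis using assms(13) k by simp
  qed
  from lie_module_smooth_tangent[OF \<Omega> F this assms(16)]
  have "smooth_on \<Omega> Z" "tangent_field F Z" by blast+
  moreover have "\<Gamma> \<subseteq> \<Omega>" using assms(17) by (auto simp: integral_curve_def)
  then have "\<Gamma> \<inter> F \<noteq> {}" using x0(1) by (auto simp: F_def M_def)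
  \<comment> \<open>\<open>Z\<close> inherits tangency from the generators, and the curve meets
    \<open>F\<close> at \<open>x0\<close>.\<close>
  ultimately have "\<Gamma> \<subseteq> F"
    using integral_curve_invariant[OF \<Omega> F _ _ assms(17)] smooth_on_Ck_on by blast
  then show ?thesis using max by (auto simp: F_def)
qed

end
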